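(* Let $\mathcal B=(\mathcal V,\mathcal E)$ be a polynomial shape Bratteli diagram associated to a homogeneous positive integer polynomial of degree $d\ge 1$ in $q\geq 2$ variables, with path space $X$. Then for any edge ordering $\xi$ of $\mathcal B$ there exists $N$ such that for each $i\geq N$ there is no depth $i$ pair of paths in $X(\xi)$. That is, the diagram $\mathcal B$ is inherently expansive: for every ordering $\xi$ the Vershik map $T=T_\xi$ is expansive on $X(\xi)$, i.e. there is an $i\geq 1$ such that the coding map $\pi_i$ is injective on $X(\xi)$.
   Context: Bratteli diagrams. A Bratteli diagram $\mathcal B=(\mathcal V,\mathcal E)$ is a graded directed graph with vertex set $\mathcal V=\bigsqcup_{n\ge0}\mathcal V_n$ ($\mathcal V_n$ finite nonempty, $\mathcal V_0$ a single vertex, the root) and edge set $\mathcal E=\bigsqcup_{n\ge 0}\mathcal E_n$ ($\mathcal E_n$ finite nonempty), each edge $e\in\mathcal E_n$ having source $s(e)\in\mathcal V_n$ and target $t(e)\in\mathcal V_{n+1}$; every vertex has an outgoing edge, every vertex other than the root has an incoming edge, and multiple edges are allowed. The path space $X$ is the set of infinite paths $x=x_0x_1\dots$, $x_n\in\mathcal E_n$, $t(x_n)=s(x_{n+1})$, with the topology generated by the cylinder sets $\{y: y_0\dots y_n=x_0\dots x_n\}$. Write $v_n(x)=s(x_n)$ for the vertex of $x$ at level $n$. Polynomial shape. Let $p(x_1,\dots,x_q)=\sum_{m_1+\dots+m_q=d}a_{(m_1,\dots,m_q)}x_1^{m_1}\cdots x_q^{m_q}$ be homogeneous of degree $d\geq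 1$ with every $a_{(m_1,\dots,m_q)}$ a positive integer. Let $S$ be the set of vectors $s\in\mathbb Z_{\ge0}^q$ whose coordinates sum to $d$. A Bratteli diagram has polynomial shape and is associated to $p$ if for every $n\ge0$, $\mathcal V_n$ is (identified with) the set of vectors in $\mathbb Z_{\geq 0}^q$ whose coordinates sum to $nd$, and for $u\in\mathcal V_n$, $w\in\mathcal V_{n+1}$ there is at least one edge from $u$ to $w$ if and only if $w-u\in S$ (the positive number of edges between connected vertices is arbitrary). Orderings and the Vershik map. An ordering is a map $\xi:\mathcal E\to\mathbb N$ which, for each vertex $w$ other than the root, restricts to a bijection from $t^{-1}\{w\}$ onto $\{1,\dots,|t^{-1}\{w\}|\}$. Two paths $x\ne y$ are tail equivalent if there is a smallest $N>0$ such that $x_n=y_n$ for all $n\ge N$; then $x<y$ iff $\xi(x_{N-1})<\xi(y_{N-1})$. A path is minimal (maximal) if all its edges are minimal (maximal) among the edges entering their targets. The Vershik map $T=T_\xi$ sends each nonmaximal path $x$ to its successor, the smallest $y>x$; it is a bijection from nonmaximal paths onto nonminimal paths. The orbit of a path is its tail equivalence class. $X'_\xi$ is the set of paths whose edges are all eventually minimal or all eventually maximal (equivalently, the union of the orbits of minimal and of maximal paths); $T$ is a bijection of $X\setminus X'_\xi$ to itself. $X(\xi)$ is the set of paths in $X\setminus X'_\xi$ having dense orbit. Codings. For $k\ge1$ let $A_k$ be the set of finite paths from the root to level $k$. The $k$-coding of $x\in X\setminus X'_\xi$ is $\pi_kx\in A_k^{\mathbb Z}$, with $(\pi_kx)_n$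 equal to the initial segment (first $k$ edges) of $T^nx$. Two paths $x,x'\in X\setminus X'_\xi$ form a depth $i$ pair if they have the same $i$-coding but not the same $(i+1)$-coding. The system with ordering $\xi$ is expansive if there is $i\ge1$ such that $\pi_i$ is injective on $X(\xi)$; the diagram is inherently expansive if for every ordering the resulting system is expansive. *)

theory Defs
  imports "HOL-Analysis.Abstract_Topology" "HOL-Library.Poly_Mapping" "HOL-Library.Disjoint_Sets" "HOL-Library.Cardinality"
begin

section \<open>Bratteli diagrams\<close>

record ('v, 'e) bratteli =
  verts :: "nat \<Rightarrow> 'v set"
  edges :: "nat \<Rightarrow> 'e set"
  src :: "'e \<Rightarrow> 'v"
  tgt :: "'e \<Rightarrow> 'v"

definition bratteli_diagram :: "('v, 'e) bratteli \<Rightarrow> bool" where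
  "bratteli_diagram B \<longleftrightarrow>
     (\<forall>n. finite (verts B n) \<and> verts B n \<noteq> {}) \<and>
     card (verts B 0) = 1 \<and>
     disjoint_family (verts B) \<and>
     (\<forall>n. finite (edges B n) \<and> edges B n \<noteq> {}) \<and>
     disjoint_family (edges B) \<and>
     (\<forall>n. \<forall>e \<in> edges B n. src B e \<in> verts B n \<and> tgt B e \<in> verts B (Suc n)) \<and>
     (\<forall>n. \<forall>v \<in> verts B n. \<exists>e \<in> edges B n. src B e = v) \<and>
     (\<forall>n. \<forall>v \<in> verts B (Suc n). \<exists>e \<in> edges B n. tgt B e = v)"

definition path_space :: "('v, 'e) bratteli \<Rightarrow> (nat \<Rightarrow> 'e) set" where
  "path_space B = {x. \<forall>n. x n \<in> edges B n \<and> tgt B (x n) = src B (x (Suc n))}"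

definition cylinder :: "('v, 'e) bratteli \<Rightarrow> (nat \<Rightarrow> 'e) \<Rightarrow> nat \<Rightarrow> (nat \<Rightarrow> 'e) set" where
  "cylinder B x n = {y \<in> path_space B. \<forall>i\<le>n. y i = x i}"

definition path_topology :: "('v, 'e) bratteli \<Rightarrow> (nat \<Rightarrow> 'e) topology" where
  "path_topology B = topology_generated_by {cylinder B x n | x n. x \<in> path_space B}"

section \<open>Polynomial shape\<close>

text \<open>Vectors in \<open>\<int>\<^sub>\<ge>\<^sub>0\<^sup>q\<close> are finitely supported maps \<open>'q \<Rightarrow>\<^sub>0 nat\<close> over a finite
  index type with \<open>CARD('q) = q\<close>, so a polynomial in \<open>q\<close> variables with integer coefficients
  is a map \<open>('q \<Rightarrow>\<^sub>0 nat) \<Rightarrow>\<^sub>0 int\<close> from exponent vectors to coefficients.\<close>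

definition vec_sum :: "('q::finite \<Rightarrow>\<^sub>0 nat) \<Rightarrow> nat" where
  "vec_sum m = (\<Sum>i\<in>UNIV. Poly_Mapping.lookup m i)"

definition vecs_of_sum :: "nat \<Rightarrow> ('q::finite \<Rightarrow>\<^sub>0 nat) set" where
  "vecs_of_sum k = {m. vec_sum m = k}"

definition homogeneous_positive :: "(('q::finite \<Rightarrow>\<^sub>0 nat) \<Rightarrow>\<^sub>0 int) \<Rightarrow> nat \<Rightarrow> bool" where
  "homogeneous_positive p d \<longleftrightarrow>
     (\<forall>m. vec_sum m \<noteq> d \<longrightarrow> Poly_Mapping.lookup p m = 0) \<and>
     (\<forall>m. vec_sum m = d \<longrightarrow> Poly_Mapping.lookup p m > 0)"

text \<open>The map \<open>\<phi>\<close> identifies the vertices of each level with vectors. Subtraction on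
  \<open>'q \<Rightarrow>\<^sub>0 nat\<close> truncates, so the condition \<open>w - u \<in> S\<close>, where \<open>S = vecs_of_sum d\<close>, is
  written with addition. The coefficients of \<open>p\<close> do not constrain the number of edges between
  connected vertices.\<close>

definition polynomial_shape ::
    "('v, 'e) bratteli \<Rightarrow> (('q::finite \<Rightarrow>\<^sub>0 nat) \<Rightarrow>\<^sub>0 int) \<Rightarrow> nat \<Rightarrow> bool" where
  "polynomial_shape B p d \<longleftrightarrow>
     bratteli_diagram B \<and> d \<ge> 1 \<and> homogeneous_positive p d \<and>
     (\<exists>\<phi> :: 'v \<Rightarrow> ('q \<Rightarrow>\<^sub>0 nat).
        (\<forall>n. bij_betw \<phi> (verts B n) (vecs_of_sum (n * d))) \<and>
        (\<forall>n. \<forall>u \<in> verts B n. \<forall>w \<in> verts B (Suc n).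
           (\<exists>e \<in> edges B n. src B e = u \<and> tgt B e = w) \<longleftrightarrow>
           (\<exists>s \<in> vecs_of_sum d. \<phi> w = \<phi> u + s)))"

section \<open>Orderings and the Vershik map\<close>

definition incoming :: "('v, 'e) bratteli \<Rightarrow> 'v \<Rightarrow> 'e set" where
  "incoming B w = {e \<in> (\<Union>n. edges B n). tgt B e = w}"

definition edge_ordering :: "('v, 'e) bratteli \<Rightarrow> ('e \<Rightarrow> nat) \<Rightarrow> bool" where
  "edge_ordering B \<xi> \<longleftrightarrow>
     (\<forall>n. \<forall>w \<in> verts B (Suc n). bij_betw \<xi> (incoming B w) {1..card (incoming B w)})"

definition tail_equiv :: "(nat \<Rightarrow> 'e) \<Rightarrow> (nat \<Rightarrow> 'e) \<Rightarrow> bool" where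
  "tail_equiv x y \<longleftrightarrow> (\<exists>N. \<forall>n\<ge>N. x n = y n)"

definition path_less :: "('e \<Rightarrow> nat) \<Rightarrow> (nat \<Rightarrow> 'e) \<Rightarrow> (nat \<Rightarrow> 'e) \<Rightarrow> bool" where
  "path_less \<xi> x y \<longleftrightarrow> x \<noteq> y \<and> tail_equiv x y \<and>
     (let N = (LEAST N. N > 0 \<and> (\<forall>n\<ge>N. x n = y n)) in \<xi> (x (N - 1)) < \<xi> (y (N - 1)))"

definition min_edge :: "('v, 'e) bratteli \<Rightarrow> ('e \<Rightarrow> nat) \<Rightarrow> 'e \<Rightarrow> bool" where
  "min_edge B \<xi> e \<longleftrightarrow> (\<forall>e' \<in> incoming B (tgt B e). \<xi> e \<le> \<xi> e')"

definition max_edge :: "('v, 'e) bratteli \<Rightarrow> ('e \<Rightarrow> nat) \<Rightarrow> 'e \<Rightarrow> bool" where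
  "max_edge B \<xi> e \<longleftrightarrow> (\<forall>e' \<in> incoming B (tgt B e). \<xi> e' \<le> \<xi> e)"

text \<open>The successor of a nonmaximal path; the value at a maximal path, which has no successor,
  is unspecified.\<close>

definition vershik :: "('v, 'e) bratteli \<Rightarrow> ('e \<Rightarrow> nat) \<Rightarrow> (nat \<Rightarrow> 'e) \<Rightarrow> (nat \<Rightarrow> 'e)" where
  "vershik B \<xi> x =
     (THE y. y \<in> path_space B \<and> path_less \<xi> x y \<and>
        (\<forall>z \<in> path_space B. path_less \<xi> x z \<longrightarrow> y = z \<or> path_less \<xi> y z))"

definition exceptional_paths :: "('v, 'e) bratteli \<Rightarrow> ('e \<Rightarrow> nat) \<Rightarrow> (nat \<Rightarrow> 'e) set" where
  "exceptional_paths B \<xi> = {x \<in> path_space B.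
     (\<exists>N. \<forall>n\<ge>N. min_edge B \<xi> (x n)) \<or> (\<exists>N. \<forall>n\<ge>N. max_edge B \<xi> (x n))}"

definition regular_paths :: "('v, 'e) bratteli \<Rightarrow> ('e \<Rightarrow> nat) \<Rightarrow> (nat \<Rightarrow> 'e) set" where
  "regular_paths B \<xi> = path_space B - exceptional_paths B \<xi>"

definition orbit :: "('v, 'e) bratteli \<Rightarrow> (nat \<Rightarrow> 'e) \<Rightarrow> (nat \<Rightarrow> 'e) set" where
  "orbit B x = {y \<in> path_space B. tail_equiv x y}"

text \<open>The set \<open>X(\<xi>)\<close>.\<close>

definition dense_orbit_paths :: "('v, 'e) bratteli \<Rightarrow> ('e \<Rightarrow> nat) \<Rightarrow> (nat \<Rightarrow> 'e) set" where
  "dense_orbit_paths B \<xi> =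
     {x \<in> regular_paths B \<xi>. path_topology B closure_of orbit B x = path_space B}"

section \<open>Codings and expansiveness\<close>

text \<open>Integer powers of the Vershik map, as a bijection of \<open>regular_paths B \<xi>\<close>.\<close>

definition vershik_pow ::
    "('v, 'e) bratteli \<Rightarrow> ('e \<Rightarrow> nat) \<Rightarrow> int \<Rightarrow> (nat \<Rightarrow> 'e) \<Rightarrow> (nat \<Rightarrow> 'e)" where
  "vershik_pow B \<xi> n =
     (if n \<ge> 0 then vershik B \<xi> ^^ nat n
      else inv_into (regular_paths B \<xi>) (vershik B \<xi>) ^^ nat (- n))"

definition coding ::
    "('v, 'e) bratteli \<Rightarrow> ('e \<Rightarrow> nat) \<Rightarrow> nat \<Rightarrow> (nat \<Rightarrow> 'e) \<Rightarrow> int \<Rightarrow> 'e list" where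
  "coding B \<xi> k x = (\<lambda>n. map (vershik_pow B \<xi> n x) [0..<k])"

definition depth_pair ::
    "('v, 'e) bratteli \<Rightarrow> ('e \<Rightarrow> nat) \<Rightarrow> nat \<Rightarrow> (nat \<Rightarrow> 'e) \<Rightarrow> (nat \<Rightarrow> 'e) \<Rightarrow> bool" where
  "depth_pair B \<xi> i x x' \<longleftrightarrow>
     x \<in> regular_paths B \<xi> \<and> x' \<in> regular_paths B \<xi> \<and>
     coding B \<xi> i x = coding B \<xi> i x' \<and>
     coding B \<xi> (Suc i) x \<noteq> coding B \<xi> (Suc i) x'"

definition expansive :: "('v, 'e) bratteli \<Rightarrow> ('e \<Rightarrow> nat) \<Rightarrow> bool" where
  "expansive B \<xi> \<longleftrightarrow> (\<exists>i\<ge>1. inj_on (coding B \<xi> i) (dense_orbit_paths B \<xi>))"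

definition inherently_expansive :: "('v, 'e) bratteli \<Rightarrow> bool" where
  "inherently_expansive B \<longleftrightarrow> (\<forall>\<xi>. edge_ordering B \<xi> \<longrightarrow> expansive B \<xi>)"

end

theory Submission
  imports Defs
begin

text \<open>
  Let \<open>x\<close> and \<open>x'\<close> have dense orbits and the same \<open>i\<close>-coding, where \<open>i \<ge> 9\<close>. At each time both orbits are
  at the same vertex of level \<open>i\<close>; call the resulting bi-infinite sequence \<open>U\<close>. The visits to the vertices
  of level \<open>i + 1\<close> cut \<open>U\<close> into finite words, in one way for \<open>x\<close> and in a possibly different way for \<open>x'\<close>.
  The word of a vertex \<open>w\<close> depends only on \<open>w\<close>, and the vertices of level \<open>i\<close> that occur in it are exactly
  the vectors \<open>u \<le> w\<close>. If the two parsings coincide then so do the \<open>(i + 1)\<close>-codings, because \<open>w\<close> and the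
  position in its word determine the initial segment (\<open>rank_inj\<close>). So there is no depth \<open>i\<close> pair, and by
  induction on the level the \<open>9\<close>-coding determines the path.

  Distances are measured from a corner of the simplex of vectors, by the sum \<open>codist c\<close> of the
  coordinates other than \<open>c\<close>. Suppose that the parsings are out of step: within a word \<open>w\<close> of one of
  them, the other one starts a word no later than the first occurrence of the source of \<open>w\<close> which is
  farthest from the corner and agrees with \<open>w\<close> off \<open>c\<close>. Then the word \<open>w'\<close> of the other parsing that
  covers this occurrence is farther from the corner than \<open>w\<close>, by at most \<open>d\<close>, and the parsings are out of
  step there with the roles exchanged (\<open>out_of_step_step\<close>). The words climb away from the corner in
  alternation, and at distance \<open>2 * d\<close> or more the consecutive words of a single parsing change their distance by at least two
  (\<open>out_of_step_two_steps\<close>). But they are parsed in their turn by the vertices \<open>z\<close> of level \<open>i + 2\<close>, and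
  the word of \<open>z\<close> contains two vertices at consecutive distances. So the parsings are never out of step
  near a corner (\<open>out_of_step_impossible\<close>).

  Two different words that start together force the parsings to be out of step near a corner. Hence,
  after a common boundary, the parsings agree (\<open>common_boundary_sync\<close>). Common boundaries occur before any
  given time: a dense orbit visits every vertex arbitrarily far in the past (\<open>dense_visits_past\<close>), in
  particular a vertex of high level at distance one from a corner. During that long visit \<open>U\<close> stays
  within distance one of the corner, and when it leaves, the words of both parsings around the exit must
  start together, since otherwise the parsings would be out of step (\<open>exit_common_boundary\<close>).

  The Vershik map enters through the position \<open>rank l x\<close> of \<open>x\<close> among the paths with the same tail from level
  \<open>l\<close> on: the map increases it by one, or else passes from the last position of one tail to the first
  position of another (\<open>vershik_regular\<close>).
\<close>

section \<open>Position of a path among the paths with the same tail\<close>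

locale ordered_bratteli =
  fixes B :: "('v, 'e) bratteli" and \<xi> :: "'e \<Rightarrow> nat"
  assumes diagram: "bratteli_diagram B" and ordering: "edge_ordering B \<xi>"
begin

text \<open>The number of finite paths from the root to a vertex of level \<open>l\<close>.\<close>

primrec height :: "nat \<Rightarrow> 'v \<Rightarrow> nat" where
  "height 0 v = 1"
| "height (Suc l) w = (\<Sum>e\<in>incoming B w. height l (src B e))"

text \<open>The number of finite paths to \<open>tgt B e\<close> whose last edge precedes the edge \<open>e\<close> of level \<open>l\<close>.\<close>

definition below :: "nat \<Rightarrow> 'e \<Rightarrow> nat" where
  "below l e = (\<Sum>e' \<in> {e' \<in> incoming B (tgt B e). \<xi> e' < \<xi> e}. height l (src B e'))"

text \<open>The number of paths that agree with \<open>x\<close> from level \<open>l\<close> on and precede \<open>x\<close>. Among the paths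
  with this tail, it takes every value less than \<open>height l (src B (x l))\<close> exactly once
  (\<open>rank_inj\<close>, \<open>rank_surj\<close>), and it represents the order (\<open>path_less_iff_rank\<close>).\<close>

primrec rank :: "nat \<Rightarrow> (nat \<Rightarrow> 'e) \<Rightarrow> nat" where
  "rank 0 x = 0"
| "rank (Suc l) x = rank l x + below l (x l)"

lemma edge_ends:
  assumes "e \<in> edges B n"
  shows "src B e \<in> verts B n" "tgt B e \<in> verts B (Suc n)"
  using diagram assms unfolding bratteli_diagram_def by blast+

lemma verts_level_unique: "v \<in> verts B m \<Longrightarrow> v \<in> verts B n \<Longrightarrow> m = n"
  using diagram unfolding bratteli_diagram_def disjoint_family_on_def by blast

lemma incoming_eq: "w \<in> verts B (Suc n) \<Longrightarrow> incoming B w = {e \<in> edges B n. tgt B e = w}"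
  unfolding incoming_def using edge_ends(2) verts_level_unique by blast

lemma finite_incoming: "w \<in> verts B (Suc n) \<Longrightarrow> finite (incoming B w)"
  using incoming_eq diagram unfolding bratteli_diagram_def by simp

lemma edge_in_incoming: "e \<in> edges B n \<Longrightarrow> e \<in> incoming B (tgt B e)"
  unfolding incoming_def by blast

lemma incoming_ne: "w \<in> verts B (Suc n) \<Longrightarrow> incoming B w \<noteq> {}"
  using incoming_eq diagram unfolding bratteli_diagram_def by blast

lemma ordering_inj:
  assumes "e \<in> edges B n" "e' \<in> edges B n" "tgt B e = tgt B e'" "\<xi> e = \<xi> e'"
  shows "e = e'"
proof -
  have "inj_on \<xi> (incoming B (tgt B e))"
    using ordering edge_ends(2)[OF assms(1)] unfolding edge_ordering_def bij_betw_def by blast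
  then show ?thesis
    using assms edge_in_incoming inj_onD by metis
qed

lemma height_pos: "v \<in> verts B l \<Longrightarrow> height l v > 0"
proof (induction l arbitrary: v)
  case (Suc l)
  obtain e where e: "e \<in> incoming B v" using incoming_ne[OF Suc.prems] by blast
  then have "e \<in> edges B l" using incoming_eq[OF Suc.prems] by blast
  then have "height l (src B e) > 0" using Suc.IH edge_ends by blast
  then show ?case
    using e finite_incoming[OF Suc.prems] by (auto simp: sum_pos2)
qed simp

text \<open>The sum on the right counts the paths through the edges of \<open>A\<close>, which include \<open>e\<close> and all
  edges that precede it.\<close>

lemma below_add_height_le:
  assumes "e \<in> edges B l" "A \<subseteq> incoming B (tgt B e)"
    "{e' \<in> incoming B (tgt B e). \<xi> e' < \<xi> e} \<subseteq> A" "e \<in> A"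
  shows "below l e + height l (src B e) \<le> (\<Sum>e'\<in>A. height l (src B e'))"
proof -
  let ?L = "{e' \<in> incoming B (tgt B e). \<xi> e' < \<xi> e}"
  have fin: "finite A"
    using finite_incoming[OF edge_ends(2)[OF assms(1)]] assms(2) finite_subset by blast
  have "below l e + height l (src B e) = (\<Sum>e'\<in>insert e ?L. height l (src B e'))"
    using finite_subset[OF assms(3) fin] by (simp add: below_def)
  also have "\<dots> \<le> (\<Sum>e'\<in>A. height l (src B e'))"
    using fin assms(3,4) by (intro sum_mono2) auto
  finally show ?thesis .
qed

lemma below_less:
  assumes "e \<in> edges B l" "e' \<in> edges B l" "tgt B e = tgt B e'" "\<xi> e < \<xi> e'"
  shows "below l e + height l (src B e) \<le> below l e'"
  unfolding below_def[of l e']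
proof (rule below_add_height_le[OF assms(1)])
  show "{e'' \<in> incoming B (tgt B e). \<xi> e'' < \<xi> e} \<subseteq> {e'' \<in> incoming B (tgt B e'). \<xi> e'' < \<xi> e'}"
    using assms by auto
qed (use assms edge_in_incoming[OF assms(1)] in auto)

lemma below_height:
  assumes "e \<in> edges B l"
  shows "below l e + height l (src B e) \<le> height (Suc l) (tgt B e)"
  using below_add_height_le[of e l "incoming B (tgt B e)"] assms edge_in_incoming by auto

text \<open>The intervals \<open>[below l e, below l e + height l (src B e))\<close>, for the edges \<open>e\<close> entering
  \<open>w\<close>, partition \<open>[0, height (Suc l) w)\<close>.\<close>

lemma below_interval_exists:
  assumes w: "w \<in> verts B (Suc l)" and r: "r < height (Suc l) w"
  obtains e where "e \<in> edges B l" "tgt B e = w" "below l e \<le> r" "r < below l e + height l (src B e)"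
proof -
  let ?c = "\<lambda>e. e \<in> edges B l \<and> tgt B e = w \<and> r < below l e + height l (src B e)"
  have inc: "\<And>e. e \<in> incoming B w \<longleftrightarrow> e \<in> edges B l \<and> tgt B e = w"
    using incoming_eq[OF w] by blast
  have ex: "\<exists>e. ?c e"
  proof -
    have "finite (\<xi> ` incoming B w)" "\<xi> ` incoming B w \<noteq> {}"
      using finite_incoming[OF w] incoming_ne[OF w] by auto
    then obtain e where e: "e \<in> incoming B w" "\<xi> e = Max (\<xi> ` incoming B w)"
      using Max_in by (metis (no_types, lifting) imageE)
    have le: "\<xi> e' \<le> \<xi> e" if "e' \<in> incoming B w" for e'
      using e that finite_incoming[OF w] by simp
    have "incoming B w = insert e {e' \<in> incoming B w. \<xi> e' < \<xi> e}"
    proof -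
      have "e' = e \<or> \<xi> e' < \<xi> e" if "e' \<in> incoming B w" for e'
        using le[OF that] that e(1) inc ordering_inj[of e' l e] by (metis le_neq_implies_less)
      then show ?thesis using e by blast
    qed
    then have "height (Suc l) w = (\<Sum>e\<in>insert e {e' \<in> incoming B w. \<xi> e' < \<xi> e}. height l (src B e))"
      by simp
    also have "\<dots> = height l (src B e) + below l e"
      using e(1)[unfolded inc] finite_incoming[OF w] by (subst sum.insert) (auto simp: below_def)
    finally show ?thesis using r e(1) inc by (auto simp: add.commute)
  qed
  \<comment> \<open>the first edge whose interval ends beyond \<open>r\<close>; its predecessor shows that it starts by \<open>r\<close>\<close>
  define e where "e = arg_min \<xi> ?c"
  have ce: "?c e" proof -
    obtain e0 where "?c e0" using ex by blast
    then show ?thesis unfolding e_def by (rule arg_min_natI)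
  qed
  have min: "\<xi> e \<le> \<xi> e'" if "?c e'" for e'
    unfolding e_def using that by (intro arg_min_nat_le) simp
  have "below l e \<le> r"
  proof (rule ccontr)
    assume neg: "\<not> below l e \<le> r"
    let ?L = "{e' \<in> incoming B w. \<xi> e' < \<xi> e}"
    have L: "below l e = (\<Sum>e'\<in>?L. height l (src B e'))" using ce by (simp add: below_def)
    then have "?L \<noteq> {}" using neg by force
    moreover have fin: "finite ?L" using finite_incoming[OF w] by simp
    ultimately have "finite (\<xi> ` ?L)" "\<xi> ` ?L \<noteq> {}" by auto
    then obtain e1 where e1: "e1 \<in> ?L" "\<xi> e1 = Max (\<xi> ` ?L)"
      using Max_in by (metis (no_types, lifting) imageE)
    have le: "\<xi> e' \<le> \<xi> e1" if "e' \<in> ?L" for e'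
      using e1 that fin by simp
    have "e' = e1 \<or> \<xi> e' < \<xi> e1" if "e' \<in> ?L" for e'
      using le[OF that] that e1(1) inc ordering_inj[of e' l e1]
      by (metis (mono_tags, lifting) le_neq_implies_less mem_Collect_eq)
    then have "?L = insert e1 {e' \<in> incoming B w. \<xi> e' < \<xi> e1}" using e1(1) by auto
    then have "below l e = (\<Sum>e'\<in>insert e1 {e' \<in> incoming B w. \<xi> e' < \<xi> e1}. height l (src B e'))"
      using L by simp
    also have "\<dots> = height l (src B e1) + below l e1"
      using e1(1) inc[of e1] finite_incoming[OF w] by (subst sum.insert) (auto simp: below_def)
    finally have "?c e1" using neg e1(1) inc by auto
    then show False using min e1(1) by fastforce
  qed
  then show ?thesis using that ce by blast
qed

lemma path_edge: "x \<in> path_space B \<Longrightarrow> x n \<in> edges B n"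
  and path_tgt: "x \<in> path_space B \<Longrightarrow> tgt B (x n) = src B (x (Suc n))"
  unfolding path_space_def by blast+

lemma rank_less: "x \<in> path_space B \<Longrightarrow> rank l x < height l (src B (x l))"
proof (induction l)
  case (Suc l)
  then have "rank l x < height l (src B (x l))" by blast
  moreover have "below l (x l) + height l (src B (x l)) \<le> height (Suc l) (src B (x (Suc l)))"
    using below_height[of "x l" l] path_edge path_tgt Suc.prems by metis
  ultimately show ?case by simp
qed simp

text \<open>The vertex at level \<open>l\<close> and the position determine the initial segment, whatever the tails.\<close>

lemma rank_inj:
  assumes "x \<in> path_space B" "y \<in> path_space B"
    "src B (x l) = src B (y l)" "rank l x = rank l y" "n < l"
  shows "x n = y n"
  using assms(3-)
proof (induction l)
  case (Suc l)
  have t: "tgt B (x l) = tgt B (y l)"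
    using Suc.prems(1) path_tgt assms by metis
  have x: "rank l x < height l (src B (x l))" and y: "rank l y < height l (src B (y l))"
    using rank_less assms by blast+
  have e: "x l \<in> edges B l" "y l \<in> edges B l" using path_edge assms by blast+
  have "\<not> \<xi> (x l) < \<xi> (y l)" "\<not> \<xi> (y l) < \<xi> (x l)"
    using below_less[of "x l" l "y l"] below_less[of "y l" l "x l"] e t x y Suc.prems(2)
    by auto
  then have eq: "x l = y l" using ordering_inj[OF e t] by linarith
  then show ?case using Suc.IH Suc.prems by (cases "n = l") auto
qed simp

lemma path_eqI:
  assumes "x \<in> path_space B" "y \<in> path_space B" "\<And>n. n \<ge> l \<Longrightarrow> x n = y n" "rank l x = rank l y"
  shows "x = y"
proof
  fix n show "x n = y n"
    using rank_inj[OF assms(1,2) _ assms(4), of n] assms(3) by (cases "n < l") auto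
qed

lemma path_from_root_exists:
  assumes "v \<in> verts B l"
  shows "\<exists>\<gamma>. (\<forall>n<l. \<gamma> n \<in> edges B n \<and> tgt B (\<gamma> n) = (if Suc n = l then v else src B (\<gamma> (Suc n))))"
  using assms
proof (induction l arbitrary: v)
  case (Suc l)
  obtain e where e: "e \<in> edges B l" "tgt B e = v"
    using Suc.prems diagram unfolding bratteli_diagram_def by blast
  obtain \<gamma> where "\<forall>n<l. \<gamma> n \<in> edges B n \<and>
      tgt B (\<gamma> n) = (if Suc n = l then src B e else src B (\<gamma> (Suc n)))"
    using Suc.IH[OF edge_ends(1)[OF e(1)]] by blast
  then show ?case using e by (intro exI[of _ "\<gamma>(l := e)"]) (auto simp: less_Suc_eq)
qed simp

text \<open>A tail can be prolonged backwards through any edge that enters it.\<close>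

lemma path_splice:
  assumes x: "x \<in> path_space B" and e: "e \<in> edges B l" "tgt B e = src B (x (Suc l))"
  obtains y where "y \<in> path_space B" "\<And>n. n \<ge> Suc l \<Longrightarrow> y n = x n" "y l = e"
proof -
  obtain \<gamma> where \<gamma>: "\<forall>n<l. \<gamma> n \<in> edges B n \<and>
      tgt B (\<gamma> n) = (if Suc n = l then src B e else src B (\<gamma> (Suc n)))"
    using path_from_root_exists[OF edge_ends(1)[OF e(1)]] by blast
  define y where "y = (\<lambda>n. if n < l then \<gamma> n else if n = l then e else x n)"
  have "y n \<in> edges B n \<and> tgt B (y n) = src B (y (Suc n))" for n
  proof (cases "n < l")
    case True
    then show ?thesis using \<gamma> by (auto simp: y_def)
  next
    case False
    then show ?thesis using e path_edge[OF x] path_tgt[OF x] by (auto simp: y_def)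
  qed
  then have "y \<in> path_space B" by (simp add: path_space_def)
  then show ?thesis by (rule that) (auto simp: y_def)
qed

lemma rank_surj:
  assumes "x \<in> path_space B" "r < height l (src B (x l))"
  obtains y where "y \<in> path_space B" "\<And>n. n \<ge> l \<Longrightarrow> y n = x n" "rank l y = r"
proof -
  have "\<exists>y \<in> path_space B. (\<forall>n\<ge>l. y n = x n) \<and> rank l y = r"
    using assms
  proof (induction l arbitrary: x r)
    case (Suc l)
    let ?w = "src B (x (Suc l))"
    have "?w \<in> verts B (Suc l)" using edge_ends path_edge Suc.prems(1) by blast
    then obtain e where e: "e \<in> edges B l" "tgt B e = ?w" "below l e \<le> r"
        "r < below l e + height l (src B e)"
      using below_interval_exists Suc.prems(2) by blast
    obtain z where z: "z \<in> path_space B" "\<And>n. n \<ge> Suc l \<Longrightarrow> z n = x n" "z l = e"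
      using path_splice[OF Suc.prems(1) e(1,2)] by blast
    obtain y where y: "y \<in> path_space B" "\<forall>n\<ge>l. y n = z n" "rank l y = r - below l e"
    proof -
      have "r - below l e < height l (src B (z l))" using e z(3) by auto
      then show ?thesis using Suc.IH[OF z(1)] that by blast
    qed
    then have "rank (Suc l) y = r" using e z(3) by simp
    then show ?case using y z by (intro bexI[of _ y]) auto
  qed auto
  then show ?thesis using that by blast
qed

lemma rank_tail:
  assumes "\<And>n. n \<ge> l \<Longrightarrow> x n = y n" "l \<le> m"
  shows "rank m y + rank l x = rank m x + rank l y"
  using assms(2)
proof (induction m rule: dec_induct)
  case (step n)
  then show ?case using assms(1)[of n] by simp
qed simp

lemma rank_Suc_less:
  assumes "x \<in> path_space B" "y \<in> path_space B" "\<And>n. n \<ge> Suc k \<Longrightarrow> x n = y n"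
    "\<xi> (x k) < \<xi> (y k)"
  shows "rank (Suc k) x < rank (Suc k) y"
proof -
  have "tgt B (x k) = tgt B (y k)" using assms(1-3) path_tgt by (metis le_refl)
  then have "below k (x k) + height k (src B (x k)) \<le> below k (y k)"
    using below_less[of "x k" k "y k"] path_edge assms by blast
  then show ?thesis using rank_less[OF assms(1), of k] by simp
qed

text \<open>On paths with a common tail, the order compares positions.\<close>

lemma path_less_iff_rank:
  assumes x: "x \<in> path_space B" and y: "y \<in> path_space B" and l: "\<And>n. n \<ge> l \<Longrightarrow> x n = y n"
  shows "path_less \<xi> x y \<longleftrightarrow> rank l x < rank l y"
proof (cases "x = y")
  case True
  then show ?thesis by (simp add: path_less_def)
next
  case False
  \<comment> \<open>\<open>k\<close> is the last level where the paths differ\<close>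
  define P where "P = (\<lambda>N. N > 0 \<and> (\<forall>n\<ge>N. x n = y n))"
  define N where "N = (LEAST N. P N)"
  have "P (Suc l)" using l by (simp add: P_def)
  then have PN: "P N" unfolding N_def by (rule LeastI)
  then obtain k where k: "N = Suc k" unfolding P_def using gr0_conv_Suc by blast
  have tl: "x n = y n" if "n \<ge> Suc k" for n using PN that unfolding P_def k by blast
  have neq: "x k \<noteq> y k"
  proof
    assume eq: "x k = y k"
    have all: "\<forall>n\<ge>k. x n = y n"
      using tl eq by (metis le_antisym not_less_eq_eq)
    then have "k = 0"
    proof -
      have "\<not> P k" using k not_less_Least[of k P] unfolding N_def[symmetric] by simp
      then show ?thesis using all by (simp add: P_def)
    qed
    then show False using all False by auto
  qed
  have kl: "Suc k \<le> l" using l neq by (meson not_less_eq_eq)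
  have t: "tgt B (x k) = tgt B (y k)"
    using tl[of "Suc k"] path_tgt[OF x, of k] path_tgt[OF y, of k] by simp
  have ne: "\<xi> (x k) \<noteq> \<xi> (y k)" using ordering_inj[OF path_edge[OF x] path_edge[OF y] t] neq by blast
  have "tail_equiv x y" unfolding tail_equiv_def using l by blast
  then have "path_less \<xi> x y \<longleftrightarrow> \<xi> (x k) < \<xi> (y k)"
    unfolding path_less_def using False k
    by (simp add: N_def[unfolded P_def, symmetric] Let_def)
  also have "\<dots> \<longleftrightarrow> rank (Suc k) x < rank (Suc k) y"
    using rank_Suc_less[of x y k] rank_Suc_less[of y x k] x y tl ne
    by (metis less_asym linorder_neqE_nat)
  also have "\<dots> \<longleftrightarrow> rank l x < rank l y"
    using rank_tail[of "Suc k" x y l] tl kl by auto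
  finally show ?thesis .
qed

section \<open>The Vershik map advances positions\<close>

lemma vershik_eqI:
  assumes x: "x \<in> path_space B" and y: "y \<in> path_space B" and l: "\<And>n. n \<ge> l \<Longrightarrow> y n = x n"
    and r: "rank l y = Suc (rank l x)"
  shows "vershik B \<xi> x = y"
proof -
  have xy: "path_less \<xi> x y" using path_less_iff_rank[OF x y, of l] l r by simp
  have succ: "y = z \<or> path_less \<xi> y z" if z: "z \<in> path_space B" "path_less \<xi> x z" for z
  proof -
    obtain k where k: "\<forall>n\<ge>k. x n = z n"
      using z(2) unfolding path_less_def tail_equiv_def by blast
    define m where "m = max k l"
    have ranky: "rank m y = Suc (rank m x)"
      using rank_tail[of l x y m] l r by (simp add: m_def)
    have zx: "\<And>n. n \<ge> m \<Longrightarrow> x n = z n" and yz: "\<And>n. n \<ge> m \<Longrightarrow> y n = z n"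
      using k l by (simp_all add: m_def)
    have "rank m x < rank m z" using path_less_iff_rank[OF x z(1) zx] z(2) by simp
    then have "rank m y = rank m z \<or> rank m y < rank m z" using ranky by linarith
    then show ?thesis
      using path_eqI[OF y z(1), of m] path_less_iff_rank[OF y z(1), of m] yz by blast
  qed
  show ?thesis unfolding vershik_def
  proof (rule the_equality)
    show "y \<in> path_space B \<and> path_less \<xi> x y \<and>
        (\<forall>z\<in>path_space B. path_less \<xi> x z \<longrightarrow> y = z \<or> path_less \<xi> y z)"
      using xy succ y by blast
  next
    fix y'
    assume y': "y' \<in> path_space B \<and> path_less \<xi> x y' \<and>
        (\<forall>z\<in>path_space B. path_less \<xi> x z \<longrightarrow> y' = z \<or> path_less \<xi> y' z)"
    show "y' = y"
    proof (rule ccontr)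
      assume "y' \<noteq> y"
      then have a: "path_less \<xi> y' y" and b: "path_less \<xi> y y'"
        using y' xy succ y by blast+
      obtain k where "\<forall>n\<ge>k. y n = y' n" using b unfolding path_less_def tail_equiv_def by blast
      then show False
        using a b path_less_iff_rank[of y y' k] path_less_iff_rank[of y' y k] y y' by auto
    qed
  qed
qed

text \<open>If \<open>y\<close> is the successor of \<open>x\<close>, then at each level \<open>l\<close> either the tails from \<open>l\<close> on agree
  and the position increases by one, or \<open>x\<close> is last for its tail and \<open>y\<close> is first for its own.
  The following lemma passes this alternative from level \<open>l + 1\<close> to level \<open>l\<close>.\<close>

lemma rank_step_down:
  assumes x: "x \<in> path_space B" and y: "y \<in> path_space B"
    and l: "(\<forall>n\<ge>Suc l. y n = x n) \<and> rank (Suc l) y = Suc (rank (Suc l) x) \<or>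
      Suc (rank (Suc l) x) = height (Suc l) (src B (x (Suc l))) \<and> rank (Suc l) y = 0"
  shows "(\<forall>n\<ge>l. y n = x n) \<and> rank l y = Suc (rank l x) \<or>
      Suc (rank l x) = height l (src B (x l)) \<and> rank l y = 0"
proof -
  have rx: "rank l x < height l (src B (x l))" and ry: "rank l y < height l (src B (y l))"
    using rank_less x y by blast+
  have ex: "x l \<in> edges B l" and ey: "y l \<in> edges B l" using path_edge x y by blast+
  consider (same) "\<forall>n\<ge>Suc l. y n = x n" "rank (Suc l) y = Suc (rank (Suc l) x)"
    | (wrap) "Suc (rank (Suc l) x) = height (Suc l) (src B (x (Suc l)))" "rank (Suc l) y = 0"
    using l by metis
  then show ?thesis
  proof cases
    case same
    have t: "tgt B (x l) = tgt B (y l)" using same(1) path_tgt x y by (metis le_refl)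
    consider "\<xi> (x l) = \<xi> (y l)" | "\<xi> (x l) < \<xi> (y l)" | "\<xi> (y l) < \<xi> (x l)" by linarith
    then show ?thesis
    proof cases
      case 1
      then have eq: "x l = y l" using ordering_inj[OF ex ey t] by blast
      have "\<forall>n\<ge>l. y n = x n"
      proof (intro allI impI)
        fix n assume "n \<ge> l"
        then show "y n = x n" using eq same(1) by (cases "n = l") auto
      qed
      then show ?thesis using eq same by simp
    next
      case 2
      then show ?thesis using below_less[OF ex ey t] same rx by simp
    next
      case 3
      then show ?thesis using below_less[OF ey ex] t same ry by simp
    qed
  next
    case wrap
    then show ?thesis using below_height[OF ex] path_tgt[OF x, of l] rx by simp
  qed
qed

lemma rank_step:
  assumes x: "x \<in> path_space B" and y: "y \<in> path_space B"
    and m: "\<And>n. n \<ge> m \<Longrightarrow> y n = x n" "rank m y = Suc (rank m x)"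
  shows "(\<forall>n\<ge>l. y n = x n) \<and> rank l y = Suc (rank l x) \<or>
      Suc (rank l x) = height l (src B (x l)) \<and> rank l y = 0"
proof (cases "l \<le> m")
  case True
  then show ?thesis
  proof (induction rule: inc_induct)
    case base
    show ?case using m by blast
  next
    case (step n)
    then show ?case using rank_step_down[OF x y] by blast
  qed
next
  case False
  then show ?thesis using rank_tail[of m x y l] m by auto
qed

lemma regularD:
  assumes "x \<in> regular_paths B \<xi>"
  shows "x \<in> path_space B" "\<exists>n\<ge>N. \<not> min_edge B \<xi> (x n)" "\<exists>n\<ge>N. \<not> max_edge B \<xi> (x n)"
  using assms unfolding regular_paths_def exceptional_paths_def by blast+

lemma regular_tail:
  assumes "x \<in> regular_paths B \<xi>" "y \<in> path_space B" "\<And>n. n \<ge> l \<Longrightarrow> y n = x n"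
  shows "y \<in> regular_paths B \<xi>"
proof -
  have "\<exists>n\<ge>N. \<not> min_edge B \<xi> (y n)" "\<exists>n\<ge>N. \<not> max_edge B \<xi> (y n)" for N
    using regularD(2,3)[OF assms(1), of "max N l"] assms(3) by (metis max.bounded_iff)+
  then show ?thesis using assms(2) unfolding regular_paths_def exceptional_paths_def by blast
qed

lemma nonmax_edge_rank:
  assumes x: "x \<in> path_space B" and n: "\<not> max_edge B \<xi> (x n)"
  shows "Suc (rank (Suc n) x) < height (Suc n) (src B (x (Suc n)))"
proof -
  have w: "tgt B (x n) \<in> verts B (Suc n)" using edge_ends path_edge x by blast
  obtain e where e: "e \<in> edges B n" "tgt B e = tgt B (x n)" "\<xi> (x n) < \<xi> e"
    using n incoming_eq[OF w] unfolding max_edge_def by (auto simp: not_le)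
  have "below n (x n) + height n (src B (x n)) \<le> below n e"
    using below_less[of "x n" n e] e path_edge[OF x] by simp
  moreover have "height n (src B e) > 0" using height_pos edge_ends e by blast
  moreover have "below n e + height n (src B e) \<le> height (Suc n) (src B (x (Suc n)))"
    using below_height[OF e(1)] e(2) path_tgt[OF x] by metis
  ultimately show ?thesis using rank_less[OF x, of n] by simp
qed

lemma nonmin_edge_rank:
  assumes x: "x \<in> path_space B" and n: "\<not> min_edge B \<xi> (x n)"
  shows "rank (Suc n) x > 0"
proof -
  have w: "tgt B (x n) \<in> verts B (Suc n)" using edge_ends path_edge x by blast
  obtain e where e: "e \<in> edges B n" "tgt B e = tgt B (x n)" "\<xi> e < \<xi> (x n)"
    using n incoming_eq[OF w] unfolding min_edge_def by (auto simp: not_le)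
  have "below n e + height n (src B e) \<le> below n (x n)"
    using below_less[of e n "x n"] e path_edge[OF x] by simp
  moreover have "height n (src B e) > 0" using height_pos edge_ends e by blast
  ultimately show ?thesis by simp
qed

lemma vershik_regular:
  assumes x: "x \<in> regular_paths B \<xi>"
  shows "vershik B \<xi> x \<in> regular_paths B \<xi>"
    and "(\<forall>n\<ge>l. vershik B \<xi> x n = x n) \<and> rank l (vershik B \<xi> x) = Suc (rank l x) \<or>
      Suc (rank l x) = height l (src B (x l)) \<and> rank l (vershik B \<xi> x) = 0"
proof -
  have xp: "x \<in> path_space B" using regularD x by blast
  obtain n where "\<not> max_edge B \<xi> (x n)" using regularD(3)[OF x] by blast
  then have "Suc (rank (Suc n) x) < height (Suc n) (src B (x (Suc n)))"
    using nonmax_edge_rank xp by blast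
  then obtain y where y: "y \<in> path_space B" "\<And>k. k \<ge> Suc n \<Longrightarrow> y k = x k"
      "rank (Suc n) y = Suc (rank (Suc n) x)"
    using rank_surj[OF xp] by blast
  have eq: "vershik B \<xi> x = y" using vershik_eqI[OF xp y] .
  show "vershik B \<xi> x \<in> regular_paths B \<xi>" using regular_tail[OF x y(1,2)] eq by simp
  show "(\<forall>n\<ge>l. vershik B \<xi> x n = x n) \<and> rank l (vershik B \<xi> x) = Suc (rank l x) \<or>
      Suc (rank l x) = height l (src B (x l)) \<and> rank l (vershik B \<xi> x) = 0"
    unfolding eq using rank_step[OF xp y] .
qed

lemma vershik_bij: "bij_betw (vershik B \<xi>) (regular_paths B \<xi>) (regular_paths B \<xi>)"
proof (rule bij_betw_imageI)
  show "inj_on (vershik B \<xi>) (regular_paths B \<xi>)"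
  proof (rule inj_onI)
    fix x y assume x: "x \<in> regular_paths B \<xi>" and y: "y \<in> regular_paths B \<xi>"
      and eq: "vershik B \<xi> x = vershik B \<xi> y"
    obtain n where n: "\<not> min_edge B \<xi> (vershik B \<xi> x n)"
      using regularD(2)[OF vershik_regular(1)[OF x]] by blast
    have "rank (Suc n) (vershik B \<xi> x) > 0"
      using nonmin_edge_rank[OF regularD(1)[OF vershik_regular(1)[OF x]] n] .
    then have "\<forall>k\<ge>Suc n. x k = y k" "rank (Suc n) x = rank (Suc n) y"
      using vershik_regular(2)[OF x, of "Suc n"] vershik_regular(2)[OF y, of "Suc n"] eq
      by auto
    then show "x = y" using path_eqI regularD(1) x y by blast
  qed
  show "vershik B \<xi> ` regular_paths B \<xi> = regular_paths B \<xi>"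
  proof
    show "vershik B \<xi> ` regular_paths B \<xi> \<subseteq> regular_paths B \<xi>" using vershik_regular by blast
    show "regular_paths B \<xi> \<subseteq> vershik B \<xi> ` regular_paths B \<xi>"
    proof
      fix x assume x: "x \<in> regular_paths B \<xi>"
      have xp: "x \<in> path_space B" using regularD x by blast
      obtain n where n: "\<not> min_edge B \<xi> (x n)" using regularD(2)[OF x] by blast
      have r: "rank (Suc n) x > 0" using nonmin_edge_rank[OF xp n] .
      then have "rank (Suc n) x - 1 < height (Suc n) (src B (x (Suc n)))"
        using rank_less[OF xp, of "Suc n"] by linarith
      then obtain y where y: "y \<in> path_space B" "\<And>k. k \<ge> Suc n \<Longrightarrow> y k = x k"
          "rank (Suc n) y = rank (Suc n) x - 1"
        using rank_surj[OF xp] by blast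
      have "vershik B \<xi> y = x"
        using vershik_eqI[of y x "Suc n"] y xp r by simp
      then show "x \<in> vershik B \<xi> ` regular_paths B \<xi>"
        using regular_tail[OF x y(1,2)] by blast
    qed
  qed
qed

lemma vershik_pow_0: "vershik_pow B \<xi> 0 x = x"
  by (simp add: vershik_pow_def)

lemma vershik_pow_regular:
  assumes x: "x \<in> regular_paths B \<xi>"
  shows "vershik_pow B \<xi> n x \<in> regular_paths B \<xi>"
proof -
  have a: "(vershik B \<xi> ^^ k) x \<in> regular_paths B \<xi>" for k
    by (induction k) (auto simp: x vershik_regular(1))
  have b: "(inv_into (regular_paths B \<xi>) (vershik B \<xi>) ^^ k) x \<in> regular_paths B \<xi>" for k
  proof (induction k)
    case (Suc k)
    then show ?case
      using bij_betw_apply[OF bij_betw_inv_into[OF vershik_bij]] by simp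
  qed (simp add: x)
  show ?thesis unfolding vershik_pow_def using a b by simp
qed

lemma vershik_pow_Suc:
  assumes x: "x \<in> regular_paths B \<xi>"
  shows "vershik_pow B \<xi> (n + 1) x = vershik B \<xi> (vershik_pow B \<xi> n x)"
proof (cases "n \<ge> 0")
  case True
  then have "nat (n + 1) = Suc (nat n)" by simp
  then show ?thesis using True by (simp add: vershik_pow_def)
next
  case False
  define I where "I = inv_into (regular_paths B \<xi>) (vershik B \<xi>)"
  define k where "k = nat (- n - 1)"
  have k: "nat (- n) = Suc k" "nat (- (n + 1)) = k" using False by (auto simp: k_def)
  have pow: "vershik_pow B \<xi> (n + 1) x = (I ^^ k) x"
    using k False by (cases "n = -1") (auto simp: vershik_pow_def I_def k_def)
  have "vershik_pow B \<xi> n x = I ((I ^^ k) x)"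
    using k False by (simp add: vershik_pow_def I_def)
  then have "vershik B \<xi> (vershik_pow B \<xi> n x) = (I ^^ k) x"
    using bij_betw_inv_into_right[OF vershik_bij vershik_pow_regular[OF x, of "n + 1"]]
    by (simp add: pow I_def)
  then show ?thesis using pow by simp
qed

text \<open>The paths that agree with \<open>T\<^sup>n x\<close> from level \<open>l\<close> on are visited during the interval of
  times \<open>[block_start l x n, block_end l x n)\<close>, in the order of their positions.\<close>

definition block_start :: "nat \<Rightarrow> (nat \<Rightarrow> 'e) \<Rightarrow> int \<Rightarrow> int" where
  "block_start l x n = n - int (rank l (vershik_pow B \<xi> n x))"

definition block_end :: "nat \<Rightarrow> (nat \<Rightarrow> 'e) \<Rightarrow> int \<Rightarrow> int" where
  "block_end l x n = block_start l x n + int (height l (src B (vershik_pow B \<xi> n x l)))"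

lemma block_bounds:
  assumes "x \<in> regular_paths B \<xi>"
  shows "block_start l x n \<le> n" "n < block_end l x n"
  using rank_less[OF regularD(1)[OF vershik_pow_regular[OF assms]], of l n]
  unfolding block_end_def block_start_def by auto

lemma block_succ:
  assumes x: "x \<in> regular_paths B \<xi>" and n: "n + 1 < block_end l x n"
  shows "\<forall>k\<ge>l. vershik_pow B \<xi> (n + 1) x k = vershik_pow B \<xi> n x k"
    and "rank l (vershik_pow B \<xi> (n + 1) x) = Suc (rank l (vershik_pow B \<xi> n x))"
  using vershik_regular(2)[OF vershik_pow_regular[OF x], of l n] n
  unfolding vershik_pow_Suc[OF x] block_end_def block_start_def by auto

lemma block_pred:
  assumes x: "x \<in> regular_paths B \<xi>" and n: "block_start l x n < n"
  shows "\<forall>k\<ge>l. vershik_pow B \<xi> (n - 1) x k = vershik_pow B \<xi> n x k"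
    and "rank l (vershik_pow B \<xi> n x) = Suc (rank l (vershik_pow B \<xi> (n - 1) x))"
  using vershik_regular(2)[OF vershik_pow_regular[OF x], of l "n - 1"] n
    vershik_pow_Suc[OF x, of "n - 1"]
  unfolding block_start_def by auto

lemma block_same:
  assumes x: "x \<in> regular_paths B \<xi>" and m: "block_start l x n \<le> m" "m < block_end l x n"
  shows "(\<forall>k\<ge>l. vershik_pow B \<xi> m x k = vershik_pow B \<xi> n x k) \<and> block_start l x m = block_start l x n"
proof (cases "m \<ge> n")
  case True
  then show ?thesis using m(2)
  proof (induction m rule: int_ge_induct)
    case (step i)
    then have IH: "\<forall>k\<ge>l. vershik_pow B \<xi> i x k = vershik_pow B \<xi> n x k"
        "block_start l x i = block_start l x n" by auto
    then have "i + 1 < block_end l x i" using step.prems by (simp add: block_end_def)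
    from block_succ[OF x this] IH show ?case by (auto simp: block_start_def)
  qed simp
next
  case False
  then have "m \<le> n" by simp
  then show ?thesis using m(1)
  proof (induction m rule: int_le_induct)
    case (step i)
    then have IH: "\<forall>k\<ge>l. vershik_pow B \<xi> i x k = vershik_pow B \<xi> n x k"
        "block_start l x i = block_start l x n" by auto
    then have "block_start l x i < i" using step.prems by simp
    from block_pred[OF x this] IH show ?case by (auto simp: block_start_def)
  qed simp
qed

text \<open>During the block, every path with the given tail is met.\<close>

lemma block_visits:
  assumes x: "x \<in> regular_paths B \<xi>" and y: "y \<in> path_space B"
    "\<And>k. k \<ge> l \<Longrightarrow> y k = vershik_pow B \<xi> n x k"
  shows "vershik_pow B \<xi> (block_start l x n + int (rank l y)) x = y"
    and "block_start l x n + int (rank l y) < block_end l x n"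
proof -
  let ?m = "block_start l x n + int (rank l y)"
  show lt: "?m < block_end l x n"
    using rank_less[OF y(1), of l] y(2) by (simp add: block_end_def)
  have "(\<forall>k\<ge>l. vershik_pow B \<xi> ?m x k = vershik_pow B \<xi> n x k) \<and>
      block_start l x ?m = block_start l x n"
    using block_same[OF x _ lt] by simp
  then show "vershik_pow B \<xi> ?m x = y"
    using path_eqI[OF regularD(1)[OF vershik_pow_regular[OF x]] y(1), of l ?m] y(2)
    by (simp add: block_start_def)
qed

end

section \<open>Vectors with a prescribed sum\<close>

lemma exists_between_with_sum:
  fixes f g :: "'q::finite \<Rightarrow> nat"
  assumes "f \<le> g" "sum f UNIV \<le> k" "k \<le> sum g UNIV"
  obtains h where "f \<le> h" "h \<le> g" "sum h UNIV = k"
proof -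
  have "\<exists>h. f \<le> h \<and> h \<le> g \<and> sum h UNIV = k"
    using assms
  proof (induction "k - sum f UNIV" arbitrary: f)
    case 0
    then show ?case by (intro exI[of _ f]) auto
  next
    case (Suc m)
    obtain a where a: "f a < g a"
    proof (rule ccontr)
      assume "\<not> thesis"
      then have "g \<le> f" unfolding le_fun_def using that not_le by blast
      then have "sum g UNIV \<le> sum f UNIV" by (simp add: sum_mono le_fun_def)
      then show False using Suc by linarith
    qed
    let ?f = "f(a := Suc (f a))"
    have s: "sum ?f UNIV = Suc (sum f UNIV)"
      by (simp add: sum.remove[of UNIV a])
    have "?f \<le> g" using a Suc.prems(1) by (auto simp: le_fun_def)
    moreover have "m = k - sum ?f UNIV" using Suc.hyps(2) s by simp
    moreover have "sum ?f UNIV \<le> k" using Suc.hyps(2) s by simp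
    ultimately obtain h where "?f \<le> h" "h \<le> g" "sum h UNIV = k"
      using Suc.hyps(1)[of ?f] Suc.prems(3) by blast
    moreover have "f \<le> ?f" by (auto simp: le_fun_def)
    ultimately show ?case using order_trans by blast
  qed
  then show ?thesis using that by blast
qed

text \<open>The sum of the coordinates other than \<open>c\<close>: the distance from the corner of the simplex
  where all the weight sits at \<open>c\<close>.\<close>

definition codist :: "'q::finite \<Rightarrow> ('q \<Rightarrow> nat) \<Rightarrow> nat" where
  "codist c w = (\<Sum>a\<in>UNIV - {c}. w a)"

lemma codist_add: "codist c w + w c = sum w UNIV"
  by (simp add: codist_def sum.remove[of UNIV c])

lemma codist_ge: "a \<noteq> c \<Longrightarrow> w a \<le> codist c w"
  unfolding codist_def by (rule member_le_sum) auto

lemma codist_mono: "(\<And>a. a \<noteq> c \<Longrightarrow> u a \<le> w a) \<Longrightarrow> codist c u \<le> codist c w"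
  unfolding codist_def by (rule sum_mono) auto

lemma codist_upd [simp]: "codist c (w(c := t)) = codist c w"
  unfolding codist_def by (rule sum.cong) auto

lemma sum_upd: "sum (w(c := t)) UNIV = codist c w + t"
  for w :: "'q::finite \<Rightarrow> nat"
  using codist_add[of c "w(c := t)"] by simp

lemma codist_eqD:
  assumes le: "\<And>a. a \<noteq> c \<Longrightarrow> u a \<le> w a" and eq: "codist c u = codist c w"
    and s: "sum u UNIV = sum w UNIV"
  shows "u = w"
proof
  fix a show "u a = w a"
  proof (cases "a = c")
    case True
    then show ?thesis using codist_add[of c u] codist_add[of c w] eq s by simp
  next
    case False
    show ?thesis
    proof (rule ccontr)
      assume "u a \<noteq> w a"
      then have "u a < w a" using le[OF False] by simp
      then have "codist c u < codist c w"
        unfolding codist_def using le False by (intro sum_strict_mono_ex1) auto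
      then show False using eq by simp
    qed
  qed
qed

lemma le_sum_eqD:
  fixes u w :: "'q::finite \<Rightarrow> nat"
  assumes "u \<le> w" "sum u UNIV = sum w UNIV"
  shows "u = w"
proof -
  have le: "u c \<le> w c" for c using assms by (simp add: le_fun_def)
  have "codist c u = codist c w" for c
    using codist_mono[of c u w, OF le] codist_add[of c u] codist_add[of c w] assms(2) le[of c]
    by linarith
  then show ?thesis using codist_eqD[of undefined u w] le assms by blast
qed

section \<open>Two parsings of one sequence\<close>

text \<open>The labels that a word labelled \<open>w\<close> contains.\<close>

definition sources :: "nat \<Rightarrow> ('q::finite \<Rightarrow> nat) \<Rightarrow> ('q \<Rightarrow> nat) set" where
  "sources k w = {u. u \<le> w \<and> sum u UNIV = k}"

text \<open>A vector \<open>w\<close> can be recovered from \<open>sources k w\<close> as the pointwise supremum, except for a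
  coordinate that exceeds \<open>k\<close>.\<close>

lemma sources_nested_le:
  assumes sub: "sources k w \<subseteq> sources k w'" and w: "w a \<le> k" "k \<le> sum w UNIV"
  shows "w a \<le> w' a"
proof -
  let ?f = "(\<lambda>_. 0)(a := w a)"
  have "sum ?f UNIV = w a" using sum_upd[of "\<lambda>_. 0" a "w a"] by (simp add: codist_def)
  moreover have "?f \<le> w" by (auto simp: le_fun_def)
  ultimately obtain h where "?f \<le> h" "h \<le> w" "sum h UNIV = k"
    using exists_between_with_sum[of ?f w k] w by auto
  then have "w a \<le> h a" "h \<in> sources k w'"
    using sub by (auto simp: sources_def le_fun_def split: if_splits)
  then show ?thesis by (auto simp: sources_def le_fun_def intro: order_trans)
qed

lemma sources_nested_eq:
  assumes sub: "sources k w \<subseteq> sources k w'" and w: "\<And>a. w a \<le> k" and k: "k \<le> sum w UNIV"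
    and s: "sum w UNIV = sum w' UNIV"
  shows "w = w'"
  using le_sum_eqD[of w w'] sources_nested_le[OF sub w k] s by (simp add: le_fun_def)

text \<open>A parsing cuts the integers into the finite intervals \<open>[s n, e n)\<close>, labelled by vectors
  \<open>W n\<close> of sum \<open>k + d\<close>; the labels \<open>U\<close> met in such an interval are exactly the vectors of sum \<open>k\<close>
  below \<open>W n\<close>.\<close>

definition parsing ::
    "nat \<Rightarrow> nat \<Rightarrow> (int \<Rightarrow> 'q::finite \<Rightarrow> nat) \<Rightarrow> (int \<Rightarrow> int) \<Rightarrow> (int \<Rightarrow> int) \<Rightarrow> (int \<Rightarrow> 'q \<Rightarrow> nat) \<Rightarrow> bool" where
  "parsing k d U s e W \<longleftrightarrow>
     (\<forall>n. s n \<le> n \<and> n < e n) \<and>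
     (\<forall>n m. s n \<le> m \<longrightarrow> m < e n \<longrightarrow> s m = s n \<and> e m = e n \<and> W m = W n) \<and>
     (\<forall>n. U ` {s n..<e n} = sources k (W n)) \<and>
     (\<forall>n. sum (W n) UNIV = k + d)"

text \<open>Intervals with equal labels spell the same word, whichever parsing they belong to.\<close>

definition same_words ::
    "(int \<Rightarrow> 'q::finite \<Rightarrow> nat) \<Rightarrow> (int \<Rightarrow> int) \<Rightarrow> (int \<Rightarrow> int) \<Rightarrow> (int \<Rightarrow> 'q \<Rightarrow> nat) \<Rightarrow>
      (int \<Rightarrow> int) \<Rightarrow> (int \<Rightarrow> int) \<Rightarrow> (int \<Rightarrow> 'q \<Rightarrow> nat) \<Rightarrow> bool" where
  "same_words U s e W s' e' W' \<longleftrightarrow>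
     (\<forall>n m. W n = W' m \<longrightarrow> e n - s n = e' m - s' m \<and>
        (\<forall>r. 0 \<le> r \<longrightarrow> r < e n - s n \<longrightarrow> U (s n + r) = U (s' m + r)))"

text \<open>What is needed of the fact that \<open>W\<close> is itself parsed one level higher: each time \<open>n\<close> lies in
  a higher interval, with label \<open>z\<close> and end \<open>a\<close>, and the next higher interval is \<open>[a, b)\<close>, with
  label \<open>z'\<close>.\<close>

definition next_parsing :: "nat \<Rightarrow> nat \<Rightarrow> (int \<Rightarrow> 'q::finite \<Rightarrow> nat) \<Rightarrow> bool" where
  "next_parsing k d W \<longleftrightarrow>
     (\<forall>n. \<exists>a>n. \<exists>b>a. \<exists>z z'. sum z UNIV = k + d + d \<and> sum z' UNIV = k + d + d \<and>
        (\<forall>m. n \<le> m \<longrightarrow> m < a \<longrightarrow> W m \<le> z) \<and> W ` {a..<b} = sources (k + d) z')"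

text \<open>The element of \<open>sources k w\<close> that keeps all coordinates of \<open>w\<close> other than \<open>c\<close>.\<close>

definition top_source :: "nat \<Rightarrow> 'q::finite \<Rightarrow> ('q \<Rightarrow> nat) \<Rightarrow> 'q \<Rightarrow> nat" where
  "top_source d c w = w(c := w c - d)"

lemma codist_top_source [simp]: "codist c (top_source d c w) = codist c w"
  by (simp add: top_source_def)

lemma top_source_in:
  assumes "sum w UNIV = k + d" "codist c w \<le> k"
  shows "top_source d c w \<in> sources k w"
proof -
  have "d \<le> w c" using codist_add[of c w] assms by linarith
  then show ?thesis
    using codist_add[of c w] assms
    by (auto simp: sources_def top_source_def sum_upd le_fun_def simp del: fun_upd_apply)
      (auto split: if_splits)
qed

lemma parsingD:
  assumes "parsing k d U s e W"
  shows "s n \<le> n" "n < e n" "s n \<le> m \<Longrightarrow> m < e n \<Longrightarrow> s m = s n"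
    "s n \<le> m \<Longrightarrow> m < e n \<Longrightarrow> e m = e n" "s n \<le> m \<Longrightarrow> m < e n \<Longrightarrow> W m = W n"
    "U ` {s n..<e n} = sources k (W n)" "sum (W n) UNIV = k + d"
  using assms unfolding parsing_def by blast+

lemma parsing_mem:
  assumes "parsing k d U s e W" "s n \<le> m" "m < e n"
  shows "U m \<in> sources k (W n)"
  using parsingD(6)[OF assms(1), of n] assms(2,3) by auto

lemma parsing_end:
  assumes p: "parsing k d U s e W"
  shows "s (e n) = e n"
proof (rule ccontr)
  assume "s (e n) \<noteq> e n"
  then have lt: "s (e n) < e n" using parsingD(1)[OF p, of "e n"] by simp
  have "e (e n - 1) = e n"
    using parsingD(4)[OF p, of n "e n - 1"] parsingD(1,2)[OF p, of n] by simp
  moreover have "e (e n - 1) = e (e n)"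
    using parsingD(4)[OF p, of "e n" "e n - 1"] parsingD(2)[OF p, of "e n"] lt by simp
  ultimately show False using parsingD(2)[OF p, of "e n"] by simp
qed

lemma parsing_start:
  assumes p: "parsing k d U s e W"
  shows "s (s n) = s n" "e (s n) = e n" "W (s n) = W n"
  using parsingD(3,4,5)[OF p, of n "s n"] parsingD(1,2)[OF p, of n] by auto

lemma parsing_boundary:
  assumes p: "parsing k d U s e W" and t: "s t = t" "t \<le> m"
  shows "t \<le> s m"
proof (rule ccontr)
  assume "\<not> t \<le> s m"
  then have "s t = s m" using parsingD(3)[OF p, of m t] parsingD(2)[OF p, of m] t by simp
  then show False using \<open>\<not> t \<le> s m\<close> t by simp
qed

lemma codist_source_le: "u \<in> sources k w \<Longrightarrow> codist c u \<le> codist c w"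
  by (rule codist_mono) (auto simp: sources_def le_fun_def)

lemma codist_source_ge:
  assumes "u \<in> sources k w" "sum w UNIV = k + d"
  shows "codist c w \<le> codist c u + d"
proof -
  have "u c \<le> w c" "sum u UNIV = k" using assms by (auto simp: sources_def le_fun_def)
  then show ?thesis using codist_add[of c w] codist_add[of c u] assms(2) by linarith
qed

text \<open>The parsing \<open>s, W\<close> is out of step at \<open>n\<close> with the parsing \<open>s'\<close>, relative to the corner \<open>c\<close>:
  the latter starts an interval at some \<open>t\<close> after the start of the word \<open>W n\<close> but not after the first
  occurrence of its top source.\<close>

definition out_of_step ::
    "nat \<Rightarrow> (int \<Rightarrow> 'q::finite \<Rightarrow> nat) \<Rightarrow> 'q \<Rightarrow> (int \<Rightarrow> int) \<Rightarrow> (int \<Rightarrow> 'q \<Rightarrow> nat) \<Rightarrow>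
      (int \<Rightarrow> int) \<Rightarrow> int \<Rightarrow> bool" where
  "out_of_step d U c s W s' n \<longleftrightarrow>
     (\<exists>t. s' t = t \<and> s n < t \<and> (\<forall>m. s n \<le> m \<longrightarrow> m < t \<longrightarrow> U m \<noteq> top_source d c (W n)))"

text \<open>Let \<open>f\<close> be the first occurrence of the top source in the word \<open>W n\<close>. The word \<open>W' f\<close> of the other
  parsing lies above this source, hence above \<open>W n\<close> off the coordinate \<open>c\<close>; it is not \<open>W n\<close>, in which
  \<open>f\<close> would come too early. So \<open>W' f\<close> is farther from the corner than \<open>W n\<close>, and its top
  source does not occur in it before \<open>e n\<close>: the parsings are out of step at \<open>f\<close> with the roles exchanged.\<close>

lemma out_of_step_step:
  assumes p: "parsing k d U s e W" and q: "parsing k d U s' e' W'"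
    and c: "same_words U s e W s' e' W'"
    and o: "out_of_step d U c s W s' n" and k: "codist c (W n) \<le> k"
  obtains f where "s n < s' f" "s' f \<le> f" "f < e n" "U f = top_source d c (W n)"
    "codist c (W n) < codist c (W' f)" "codist c (W' f) \<le> codist c (W n) + d"
    "out_of_step d U c s' W' s f"
    "\<forall>m. s' f \<le> m \<longrightarrow> m < e n \<longrightarrow> U m \<noteq> top_source d c (W' f)"
    "\<forall>m. s n \<le> m \<longrightarrow> m < f \<longrightarrow> U m \<noteq> top_source d c (W n)"
proof -
  let ?u = "top_source d c (W n)"
  obtain t where t: "s' t = t" "s n < t" "\<And>m. s n \<le> m \<Longrightarrow> m < t \<Longrightarrow> U m \<noteq> ?u"
    using o unfolding out_of_step_def by blast
  have "?u \<in> U ` {s n..<e n}"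
    using top_source_in[OF parsingD(7)[OF p] k] parsingD(6)[OF p] by blast
  then obtain f0 where f0: "s n \<le> f0" "f0 < e n" "U f0 = ?u" by auto
  define P where "P = (\<lambda>j. U (s n + int j) = ?u)"
  have "P (nat (f0 - s n))" using f0 by (simp add: P_def)
  define j where "j = (LEAST j. P j)"
  have Pj: "P j" unfolding j_def using \<open>P (nat (f0 - s n))\<close> by (rule LeastI)
  have jle: "j \<le> nat (f0 - s n)" unfolding j_def using \<open>P (nat (f0 - s n))\<close> by (rule Least_le)
  define f where "f = s n + int j"
  have Uf: "U f = ?u" using Pj by (simp add: P_def f_def)
  have fs: "s n \<le> f" and fe: "f < e n" using jle f0 by (auto simp: f_def)
  have first: "U m \<noteq> ?u" if "s n \<le> m" "m < f" for m
  proof -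
    have "nat (m - s n) < j" using that by (simp add: f_def)
    then have "\<not> P (nat (m - s n))" unfolding j_def by (rule not_less_Least)
    then show ?thesis using that by (simp add: P_def)
  qed
  have tf: "t \<le> f" using t(3)[OF fs] Uf by (meson not_le)
  have ts: "t \<le> s' f" using parsing_boundary[OF q t(1) tf] .
  have s'f: "s' f \<le> f" "f < e' f" using parsingD(1,2)[OF q] by auto
  have ne: "W n \<noteq> W' f"
  proof
    assume eq: "W n = W' f"
    then have len: "e n - s n = e' f - s' f"
      and word: "\<And>r. 0 \<le> r \<Longrightarrow> r < e n - s n \<Longrightarrow> U (s n + r) = U (s' f + r)"
      using c unfolding same_words_def by blast+
    have "U (s n + (f - s' f)) = U f" using word[of "f - s' f"] s'f len by simp
    then show False using first[of "s n + (f - s' f)"] Uf s'f ts t(2) by simp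
  qed
  have src: "?u \<in> sources k (W' f)" using parsing_mem[OF q s'f] Uf by simp
  have le: "W n a \<le> W' f a" if "a \<noteq> c" for a
    using src that by (auto simp: sources_def top_source_def le_fun_def split: if_splits)
  have lt: "codist c (W n) < codist c (W' f)"
  proof (rule ccontr)
    assume "\<not> ?thesis"
    then have "codist c (W n) = codist c (W' f)" using codist_mono[of c "W n" "W' f", OF le] by simp
    then show False
      using codist_eqD[of c "W n" "W' f", OF le] ne parsingD(7)[OF p] parsingD(7)[OF q] by simp
  qed
  have up: "codist c (W' f) \<le> codist c (W n) + d"
    using codist_source_ge[OF src parsingD(7)[OF q], of c] by simp
  have none: "U m \<noteq> top_source d c (W' f)" if "s' f \<le> m" "m < e n" for m
  proof
    assume "U m = top_source d c (W' f)"
    then have "codist c (W' f) = codist c (U m)" by simp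
    also have "\<dots> \<le> codist c (W n)"
      using codist_source_le[OF parsing_mem[OF p, of n m]] that ts t(2) by simp
    finally show False using lt by simp
  qed
  have "out_of_step d U c s' W' s f"
    unfolding out_of_step_def using none parsing_end[OF p, of n] s'f fe by (intro exI[of _ "e n"]) auto
  then show ?thesis using that[of f] ts t(2) s'f(1) fe Uf lt up none first by auto
qed

text \<open>At distances between \<open>2 * d\<close> and \<open>k\<close> from the corner the sources of a word do not properly contain
  those of another, so two steps lead from one word to the word right after it.\<close>

lemma out_of_step_two_steps:
  assumes p: "parsing k d U s e W" and q: "parsing k d U s' e' W'"
    and c: "same_words U s e W s' e' W'" "same_words U s' e' W' s e W"
    and o: "out_of_step d U c s W s' n"
    and k: "codist c (W n) + 2 * d \<le> k" "2 * d \<le> codist c (W n)" and d: "d \<ge> 1"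
  shows "out_of_step d U c s W s' (e n)"
    and "codist c (W n) + 2 \<le> codist c (W (e n))"
    and "codist c (W (e n)) \<le> codist c (W n) + 2 * d"
proof -
  obtain f where f: "s n < s' f" "s' f \<le> f" "f < e n" "U f = top_source d c (W n)"
      "codist c (W n) < codist c (W' f)" "codist c (W' f) \<le> codist c (W n) + d"
      "out_of_step d U c s' W' s f"
      "\<forall>m. s' f \<le> m \<longrightarrow> m < e n \<longrightarrow> U m \<noteq> top_source d c (W' f)"
  proof -
    have "codist c (W n) \<le> k" using k(1) by simp
    from out_of_step_step[OF p q c(1) o this] show ?thesis using that by metis
  qed
  have kf: "codist c (W' f) \<le> k" using f(6) k(1) by simp
  obtain g where g: "s' f < s g" "s g \<le> g" "g < e' f" "U g = top_source d c (W' f)"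
      "codist c (W' f) < codist c (W g)" "codist c (W g) \<le> codist c (W' f) + d"
      "out_of_step d U c s W s' g"
      "\<forall>m. s' f \<le> m \<longrightarrow> m < g \<longrightarrow> U m \<noteq> top_source d c (W' f)"
    using out_of_step_step[OF q p c(2) f(7) kf] by metis
  let ?v = "W (e n)"
  have se: "s (e n) = e n" by (rule parsing_end[OF p])
  have "\<not> g < e n" using f(8) g(1,2,4) by auto
  then have eg: "e n \<le> s g" using parsing_boundary[OF p se] by simp
  \<comment> \<open>otherwise the word that starts at \<open>e n\<close> would lie within the word \<open>W' f\<close>\<close>
  have "s g = e n"
  proof (rule ccontr)
    assume "s g \<noteq> e n"
    then have lt: "e n < s g" using eg by simp
    have inside: "e (e n) \<le> s g"
    proof (rule ccontr)
      assume "\<not> e (e n) \<le> s g"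
      then have "s (s g) = s (e n)" using parsingD(3)[OF p, of "e n" "s g"] se lt by simp
      then show False using parsing_start(1)[OF p] se lt by simp
    qed
    have src: "sources k ?v = U ` {e n..<e (e n)}" using parsingD(6)[OF p, of "e n"] se by simp
    have sub: "sources k ?v \<subseteq> sources k (W' f)"
    proof
      fix u assume "u \<in> sources k ?v"
      then obtain m where m: "u = U m" "e n \<le> m" "m < e (e n)" using src by auto
      then show "u \<in> sources k (W' f)"
        using parsing_mem[OF q, of f m] inside f(2,3) g(2,3) by simp
    qed
    have ne: "?v \<noteq> W' f"
    proof
      assume "?v = W' f"
      then have "top_source d c (W' f) \<in> U ` {e n..<e (e n)}"
        using top_source_in[OF parsingD(7)[OF q] kf] src by simp
      then obtain m where "U m = top_source d c (W' f)" "e n \<le> m" "m < e (e n)" by force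
      then show False using g(8) inside f(2,3) g(2) by (meson order_less_le_trans order_trans less_imp_le)
    qed
    have vsum: "sum ?v UNIV = k + d" by (rule parsingD(7)[OF p])
    have "U (e n) \<in> sources k ?v" using src parsingD(2)[OF p, of "e n"] by simp
    then have "codist c (W' f) \<le> codist c ?v + d"
      using codist_source_ge[OF subsetD[OF sub] parsingD(7)[OF q], of "U (e n)" c]
        codist_source_le[of "U (e n)" k ?v c] by linarith
    then have "d \<le> codist c ?v" using k(2) f(5) by linarith
    then have vc: "?v c \<le> k" using codist_add[of c ?v] vsum by linarith
    have "codist c ?v \<le> k"
    proof (rule ccontr)
      assume gt: "\<not> codist c ?v \<le> k"
      have "(\<lambda>_. 0) \<le> ?v(c := 0)" by (simp add: le_fun_def)
      moreover have "k \<le> sum (?v(c := 0)) UNIV" using gt unfolding sum_upd by simp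
      ultimately obtain u where u: "u \<le> ?v(c := 0)" "sum u UNIV = k"
        using exists_between_with_sum[of "\<lambda>_. 0" "?v(c := 0)" k] by (metis sum.neutral_const le0)
      have "u c = 0" using le_funD[OF u(1), of c] by simp
      have "u \<le> ?v"
      proof (rule le_funI)
        fix a show "u a \<le> ?v a" using le_funD[OF u(1), of a] by (cases "a = c") auto
      qed
      then have "u \<in> sources k (W' f)" using sub u(2) by (auto simp: sources_def)
      then have "codist c u \<le> codist c (W' f)" by (rule codist_source_le)
      then show False using codist_add[of c u] u(2) \<open>u c = 0\<close> f(6) k(1) d by linarith
    qed
    then have "?v a \<le> k" for a using vc codist_ge[of a c ?v] by (cases "a = c") auto
    then show False using sources_nested_eq[OF sub] vsum parsingD(7)[OF q] ne by simp
  qed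
  then have Wg: "W (e n) = W g" using parsing_start(3)[OF p, of g] by simp
  show "out_of_step d U c s W s' (e n)"
    using g(7) \<open>s g = e n\<close> se Wg by (simp add: out_of_step_def)
  show "codist c (W n) + 2 \<le> codist c (W (e n))"
    using f(5) g(5) Wg by simp
  show "codist c (W (e n)) \<le> codist c (W n) + 2 * d"
    using f(6) g(6) Wg by simp
qed

text \<open>Hence, from a time out of step on, the labels move away from the corner and skip a distance
  whenever they change, for as long as the distance stays at most \<open>k - 2 * d\<close>.\<close>

lemma out_of_step_rises:
  assumes p: "parsing k d U s e W" and q: "parsing k d U s' e' W'"
    and c: "same_words U s e W s' e' W'" "same_words U s' e' W' s e W"
    and o: "out_of_step d U c s W s' n0"
    and k: "2 * d \<le> codist c (W n0)" and d: "d \<ge> 1"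
    and n: "n0 \<le> n" "\<forall>m. n0 \<le> m \<longrightarrow> m < n \<longrightarrow> codist c (W m) + 2 * d \<le> k"
  shows "out_of_step d U c s W s' n \<and> 2 * d \<le> codist c (W n) \<and>
    (\<forall>m. n0 \<le> m \<longrightarrow> m \<le> n \<longrightarrow> codist c (W m) = codist c (W n) \<or> codist c (W m) + 2 \<le> codist c (W n)) \<and>
    (n0 < n \<longrightarrow> codist c (W n) \<le> codist c (W (n - 1)) + 2 * d)"
  using n
proof (induction n rule: int_ge_induct)
  case base
  then show ?case using o k by auto
next
  case (step n)
  have IH: "out_of_step d U c s W s' n" "2 * d \<le> codist c (W n)"
    "\<And>m. n0 \<le> m \<Longrightarrow> m \<le> n \<Longrightarrow> codist c (W m) = codist c (W n) \<or> codist c (W m) + 2 \<le> codist c (W n)"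
    using step.IH step.prems by auto
  show ?case
  proof (cases "n + 1 < e n")
    case True
    then have "s (n + 1) = s n" "W (n + 1) = W n"
      using parsingD(3,5)[OF p, of n "n + 1"] parsingD(1)[OF p, of n] by auto
    moreover have "codist c (W m) = codist c (W n) \<or> codist c (W m) + 2 \<le> codist c (W n)"
      if "n0 \<le> m" "m \<le> n + 1" for m
      using IH(3)[of m] that calculation(2) by (cases "m = n + 1") auto
    ultimately show ?thesis using IH(1,2) by (simp add: out_of_step_def)
  next
    case False
    then have e: "e n = n + 1" using parsingD(2)[OF p, of n] by simp
    have kn: "codist c (W n) + 2 * d \<le> k" using step.prems step.hyps by simp
    note two = out_of_step_two_steps[OF p q c IH(1) kn IH(2) d, unfolded e]
    have "codist c (W m) = codist c (W (n + 1)) \<or> codist c (W m) + 2 \<le> codist c (W (n + 1))"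
      if "n0 \<le> m" "m \<le> n + 1" for m
      using IH(3)[of m] that two(2) by (cases "m = n + 1") auto
    then show ?thesis using two IH(2) by simp
  qed
qed

text \<open>This contradicts the parsing of the next level, one of whose words lies in the rising stretch
  but contains labels at two consecutive distances.\<close>

lemma out_of_step_impossible_far:
  assumes p: "parsing k d U s e W" and q: "parsing k d U s' e' W'"
    and c: "same_words U s e W s' e' W'" "same_words U s' e' W' s e W"
    and next_p: "next_parsing k d W"
    and o: "out_of_step d U c s W s' n0"
    and n0: "2 * d \<le> codist c (W n0)" "codist c (W n0) < 3 * d" and d: "d \<ge> 1" and k: "9 * d \<le> k"
  shows False
proof -
  obtain a b z z' where ab: "n0 < a" "a < b" and z: "sum z UNIV = k + d + d"
    and z': "sum z' UNIV = k + d + d"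
    and Wz: "\<And>m. n0 \<le> m \<Longrightarrow> m < a \<Longrightarrow> W m \<le> z" and Wz': "W ` {a..<b} = sources (k + d) z'"
    using next_p unfolding next_parsing_def by (metis (no_types, lifting))
  note rises = out_of_step_rises[OF p q c o n0(1) d]
  have Wsum: "sum (W m) UNIV = k + d" for m by (rule parsingD(7)[OF p])
  have zd: "codist c z \<le> codist c (W n0) + d"
    using codist_source_ge[of "W n0" "k + d" z d c] Wz[of n0] ab z Wsum by (simp add: sources_def)
  \<comment> \<open>A word of the next level varies the distance by at most \<open>d\<close>, and the label changes by at most
    \<open>2 * d\<close> at \<open>a\<close>: up to the time \<open>b\<close> the distance is at most \<open>7 * d\<close>.\<close>
  have below_a: "codist c (W m) \<le> 4 * d" if "n0 \<le> m" "m < a" for m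
    using codist_mono[of c "W m" z] Wz[OF that] zd n0(2) by (simp add: le_fun_def)
  have Ra: "2 * d \<le> codist c (W a)" "codist c (W a) \<le> codist c (W (a - 1)) + 2 * d"
    using rises[of a] ab below_a k by force+
  then have Wa: "codist c (W a) \<le> 6 * d" using below_a[of "a - 1"] ab by simp
  have "W a \<in> sources (k + d) z'" using Wz' ab by force
  then have z'd: "codist c z' \<le> 7 * d" "2 * d \<le> codist c z'"
    using codist_source_ge[of "W a" "k + d" z' d c] codist_source_le[of "W a" "k + d" z' c] z' Wa Ra
    by auto
  have below_b: "codist c (W m) \<le> 7 * d" if m: "n0 \<le> m" "m < b" for m
  proof (cases "m < a")
    case False
    then have "W m \<in> sources (k + d) z'" using Wz' m by force
    then show ?thesis using codist_source_le[of "W m" "k + d" z' c] z'd by simp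
  qed (use below_a[of m] m in simp)
  have rises_b: "codist c (W m) = codist c (W n) \<or> codist c (W m) + 2 \<le> codist c (W n)"
    if "n0 \<le> m" "m \<le> n" "n < b" for m n
    using rises[of n] below_b that k by force
  have z'c: "z' c = k + d + d - codist c z'" using codist_add[of c z'] z' by simp
  obtain c' where c': "c' \<noteq> c" "z' c' \<ge> 1"
  proof (rule ccontr)
    assume "\<not> thesis"
    then have "codist c z' = 0" unfolding codist_def using that by (force simp: not_le)
    then show False using z'd d by simp
  qed
  \<comment> \<open>two labels below \<open>z'\<close> at consecutive distances from the corner\<close>
  define w1 where "w1 = z'(c := z' c - d)"
  define w2 where "w2 = z'(c' := z' c' - 1, c := z' c - (d - 1))"
  have w1: "codist c w1 = codist c z'" by (simp add: w1_def)
  have w2: "codist c w2 + 1 = codist c z'"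
  proof -
    have "codist c w2 = codist c (z'(c' := z' c' - 1))" by (simp add: w2_def)
    moreover have "codist c (z'(c' := z' c' - 1)) + 1 = codist c z'"
      unfolding codist_def using c' by (subst (1 2) sum.remove[of _ c']) auto
    ultimately show ?thesis by simp
  qed
  have "w1 \<in> sources (k + d) z'"
    using w1 codist_add[of c w1] z'c z'd k by (auto simp: sources_def w1_def le_fun_def)
  then obtain m1 where m1: "a \<le> m1" "m1 < b" "W m1 = w1" using Wz' by (metis atLeastLessThan_iff imageE)
  have "w2 c = z' c - (d - 1)" by (simp add: w2_def)
  then have "sum w2 UNIV = k + d" using w2 codist_add[of c w2] z'c z'd k d by linarith
  moreover have "w2 \<le> z'" by (auto simp: w2_def le_fun_def)
  ultimately have "w2 \<in> sources (k + d) z'" by (simp add: sources_def)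
  then obtain m2 where m2: "a \<le> m2" "m2 < b" "W m2 = w2" using Wz' by (metis atLeastLessThan_iff imageE)
  show False
    using rises_b[of m1 m2] rises_b[of m2 m1] m1 m2 ab w1 w2 by (cases "m1 \<le> m2") auto
qed

lemma out_of_step_impossible:
  assumes p: "parsing k d U s e W" and q: "parsing k d U s' e' W'"
    and c: "same_words U s e W s' e' W'" "same_words U s' e' W' s e W"
    and nx: "next_parsing k d W" "next_parsing k d W'"
    and o: "out_of_step d U c s W s' n"
    and n: "codist c (W n) < 3 * d" and d: "d \<ge> 1" and k: "9 * d \<le> k"
  shows False
  using assms
proof (induction "2 * d - codist c (W n)" arbitrary: s e W s' e' W' n rule: less_induct)
  case less
  show ?case
  proof (cases "2 * d \<le> codist c (W n)")
    case True
    then show ?thesis using out_of_step_impossible_far[OF less.prems(1-5,7)] less.prems by blast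
  next
    case False
    then have kn: "codist c (W n) \<le> k" using k by linarith
    obtain f where f: "codist c (W n) < codist c (W' f)" "codist c (W' f) \<le> codist c (W n) + d"
        "out_of_step d U c s' W' s f"
      using out_of_step_step[OF less.prems(1,2,3,7) kn] by metis
    show ?thesis
    proof (rule less.hyps[OF _ less.prems(2,1,4,3,6,5) f(3) _ d k])
      show "2 * d - codist c (W' f) < 2 * d - codist c (W n)" using f(1) False by linarith
      show "codist c (W' f) < 3 * d" using f(2) False by linarith
    qed
  qed
qed

text \<open>Two words that start together coincide: otherwise the shorter one has its sources among those
  of the longer one, which happens only near a corner, and there the longer word would be out of step
  at its start.\<close>

lemma common_boundary_same_label_aux:
  assumes p: "parsing k d U s e W" and q: "parsing k d U s' e' W'"
    and c: "same_words U s e W s' e' W'" "same_words U s' e' W' s e W"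
    and nx: "next_parsing k d W" "next_parsing k d W'"
    and d: "d \<ge> 1" and k: "9 * d \<le> k"
    and j: "s j = j" "s' j = j" "e j \<le> e' j"
  shows "W j = W' j"
proof (rule ccontr)
  assume ne: "W j \<noteq> W' j"
  have sub: "sources k (W j) \<subseteq> sources k (W' j)"
    using parsingD(6)[OF p, of j] parsingD(6)[OF q, of j] j by (metis image_mono ivl_subset order_refl)
  have sums: "sum (W j) UNIV = k + d" "sum (W' j) UNIV = k + d" using parsingD(7) p q by blast+
  obtain c where gt: "W j c > k"
    using sources_nested_eq[OF sub] sums ne by (metis le_add1 not_le)
  then have dj: "codist c (W j) < d" using codist_add[of c "W j"] sums by linarith
  have le: "W j a \<le> W' j a" if "a \<noteq> c" for a
    using sources_nested_le[OF sub, of a] codist_ge[of a c "W j"] that dj k sums d by simp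
  let ?u = "(\<lambda>_. 0)(c := k)"
  have "?u \<in> sources k (W j)"
    using gt sum_upd[of "\<lambda>_. 0" c k] by (auto simp: sources_def le_fun_def codist_def)
  then have "?u \<le> W' j" using sub by (auto simp: sources_def)
  then have "k \<le> W' j c" using le_funD[of ?u "W' j" c] by simp
  then have d'j: "codist c (W' j) \<le> d" using codist_add[of c "W' j"] sums by linarith
  have lt: "codist c (W j) < codist c (W' j)"
  proof (rule ccontr)
    assume "\<not> ?thesis"
    then have "codist c (W j) = codist c (W' j)" using codist_mono[of c "W j" "W' j", OF le] by simp
    then show False using codist_eqD[of c "W j" "W' j", OF le] ne sums by simp
  qed
  have "out_of_step d U c s' W' s j" unfolding out_of_step_def
  proof (intro exI[of _ "e j"] conjI allI impI)
    show "s (e j) = e j" by (rule parsing_end[OF p])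
    show "s' j < e j" using j parsingD(2)[OF p, of j] by simp
    fix m assume m: "s' j \<le> m" "m < e j"
    then have "codist c (U m) \<le> codist c (W j)"
      using codist_source_le[OF parsing_mem[OF p, of j m]] j by simp
    then show "U m \<noteq> top_source d c (W' j)" using lt by auto
  qed
  then show False
    using out_of_step_impossible[OF q p c(2,1) nx(2,1) _ _ d k, of c j] d'j d by simp
qed

lemma common_boundary_same_label:
  assumes p: "parsing k d U s e W" and q: "parsing k d U s' e' W'"
    and c: "same_words U s e W s' e' W'" "same_words U s' e' W' s e W"
    and nx: "next_parsing k d W" "next_parsing k d W'"
    and d: "d \<ge> 1" and k: "9 * d \<le> k"
    and j: "s j = j" "s' j = j"
  shows "W j = W' j \<and> e j = e' j"
proof -
  have eq: "W j = W' j"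
    using common_boundary_same_label_aux[OF p q c nx d k j]
      common_boundary_same_label_aux[OF q p c(2,1) nx(2,1) d k j(2,1)] by (cases "e j \<le> e' j") auto
  then have "e j - s j = e' j - s' j" using c(1) unfolding same_words_def by blast
  then show ?thesis using eq j by simp
qed

text \<open>After a common boundary the parsings agree.\<close>

lemma common_boundary_sync:
  assumes p: "parsing k d U s e W" and q: "parsing k d U s' e' W'"
    and c: "same_words U s e W s' e' W'" "same_words U s' e' W' s e W"
    and nx: "next_parsing k d W" "next_parsing k d W'"
    and d: "d \<ge> 1" and k: "9 * d \<le> k"
    and j: "s j = j" "s' j = j" and n: "j \<le> n"
  shows "s n = s' n \<and> e n = e' n \<and> W n = W' n"
  using n
proof (induction n rule: int_ge_induct)
  case base
  then show ?case using common_boundary_same_label[OF p q c nx d k j] j by simp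
next
  case (step n)
  show ?case
  proof (cases "n + 1 < e n")
    case True
    then show ?thesis
      using step.IH parsingD(3,4,5)[OF p, of n "n + 1"] parsingD(3,4,5)[OF q, of n "n + 1"]
        parsingD(1)[OF p, of n] parsingD(1)[OF q, of n] by simp
  next
    case False
    then have e: "e n = n + 1" using parsingD(2)[OF p, of n] by simp
    then have "s (n + 1) = n + 1" "s' (n + 1) = n + 1"
      using parsing_end[OF p, of n] parsing_end[OF q, of n] step.IH by auto
    then show ?thesis using common_boundary_same_label[OF p q c nx d k] by simp
  qed
qed

text \<open>If the labels \<open>U\<close> stay within distance one of a corner for a while and then leave at time \<open>m\<close>,
  then the words around \<open>m\<close> start together. The top source of such a word is at distance two or
  more, so it does not occur while \<open>U\<close> is near the corner; if the starts differed, the word that starts first would be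
  out of step.\<close>

lemma exit_same_start_aux:
  assumes p: "parsing k d U s e W" and q: "parsing k d U s' e' W'"
    and c: "same_words U s e W s' e' W'" "same_words U s' e' W' s e W"
    and nx: "next_parsing k d W" "next_parsing k d W'"
    and d: "d \<ge> 1" and k: "9 * d \<le> k"
    and run: "\<And>l. s m \<le> l \<Longrightarrow> l < m \<Longrightarrow> codist c (U l) \<le> 1" and exit: "codist c (U m) \<ge> 2"
  shows "s' m \<le> s m"
proof (rule ccontr)
  assume "\<not> s' m \<le> s m"
  then have lt: "s m < s' m" by simp
  have m: "s m \<le> m" "m < e m" "s' m \<le> m" using parsingD(1,2) p q by blast+
  have "codist c (U m) \<le> codist c (W m)" by (rule codist_source_le[OF parsing_mem[OF p m(1,2)]])
  then have big: "codist c (W m) \<ge> 2" using exit by simp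
  have "U (s m) \<in> sources k (W m)" using parsing_mem[OF p, of m "s m"] m by simp
  then have "codist c (W m) \<le> codist c (U (s m)) + d"
    using codist_source_ge parsingD(7)[OF p] by blast
  then have small: "codist c (W m) < 3 * d" using run[of "s m"] lt m d by simp
  have "out_of_step d U c s W s' m" unfolding out_of_step_def
  proof (intro exI[of _ "s' m"] conjI allI impI)
    show "s' (s' m) = s' m" by (rule parsing_start[OF q])
    fix l assume "s m \<le> l" "l < s' m"
    then have "codist c (U l) \<le> 1" using run m by simp
    then show "U l \<noteq> top_source d c (W m)" using big by auto
  qed (rule lt)
  then show False using out_of_step_impossible[OF p q c nx _ small d k] by blast
qed

lemma exit_common_boundary:
  assumes p: "parsing k d U s e W" and q: "parsing k d U s' e' W'"
    and c: "same_words U s e W s' e' W'" "same_words U s' e' W' s e W"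
    and nx: "next_parsing k d W" "next_parsing k d W'"
    and d: "d \<ge> 1" and k: "9 * d \<le> k"
    and run: "\<And>l. n \<le> l \<Longrightarrow> l < m \<Longrightarrow> codist c (U l) \<le> 1" and exit: "codist c (U m) \<ge> 2"
    and n: "n \<le> s m" "n \<le> s' m"
  shows "s m = s' m"
proof (rule order_antisym)
  show "s' m \<le> s m"
    using run n(1) exit by (intro exit_same_start_aux[OF p q c nx d k, of m c]) auto
  show "s m \<le> s' m"
    using run n(2) exit by (intro exit_same_start_aux[OF q p c(2,1) nx(2,1) d k, of m c]) auto
qed

section \<open>Diagrams whose vertices are vectors\<close>

text \<open>The vertices of level \<open>n\<close> correspond to the vectors of sum \<open>n * d\<close>, and edges lead exactly from
  the smaller to the larger vectors of consecutive levels.\<close>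

locale labelled_bratteli = ordered_bratteli B \<xi>
  for B :: "('v, 'e) bratteli" and \<xi> :: "'e \<Rightarrow> nat" +
  fixes lab :: "'v \<Rightarrow> 'q::finite \<Rightarrow> nat" and d :: nat
  assumes d: "d \<ge> 1"
    and lab_bij: "\<And>n. bij_betw lab (verts B n) {f. sum f UNIV = n * d}"
    and edge_iff: "\<And>n u w. u \<in> verts B n \<Longrightarrow> w \<in> verts B (Suc n) \<Longrightarrow>
      (\<exists>e \<in> edges B n. src B e = u \<and> tgt B e = w) \<longleftrightarrow> lab u \<le> lab w"
begin

lemma lab_sum: "v \<in> verts B n \<Longrightarrow> sum (lab v) UNIV = n * d"
  using bij_betw_apply[OF lab_bij] by blast

lemma lab_inj: "u \<in> verts B n \<Longrightarrow> v \<in> verts B n \<Longrightarrow> lab u = lab v \<Longrightarrow> u = v"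
  using lab_bij[of n] unfolding bij_betw_def by (blast dest: inj_onD)

lemma lab_surj:
  assumes "sum f UNIV = n * d"
  obtains v where "v \<in> verts B n" "lab v = f"
proof -
  have "f \<in> lab ` verts B n" using bij_betw_imp_surj_on[OF lab_bij[of n]] assms by blast
  then show ?thesis using that by blast
qed

lemma path_vert: "x \<in> path_space B \<Longrightarrow> src B (x n) \<in> verts B n"
  using edge_ends(1) path_edge by blast

lemma edge_lab_le: "e \<in> edges B n \<Longrightarrow> lab (src B e) \<le> lab (tgt B e)"
  using edge_iff edge_ends by blast

lemma path_lab_mono:
  assumes x: "x \<in> path_space B" and mn: "m \<le> n"
  shows "lab (src B (x m)) \<le> lab (src B (x n))"
  using mn
proof (induction n rule: dec_induct)
  case (step n)
  have "lab (src B (x n)) \<le> lab (src B (x (Suc n)))"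
    using edge_lab_le[OF path_edge[OF x, of n]] path_tgt[OF x, of n] by simp
  then show ?case using step.IH by simp
qed simp

lemma path_through_lower_vertex:
  assumes x: "x \<in> path_space B" and u: "u \<in> verts B a" and ab: "a \<le> b"
    and le: "lab u \<le> lab (src B (x b))"
  obtains y where "y \<in> path_space B" "\<And>n. n \<ge> b \<Longrightarrow> y n = x n" "src B (y a) = u"
proof -
  have "\<exists>y \<in> path_space B. (\<forall>n\<ge>b. y n = x n) \<and> src B (y a) = u"
    using ab x le
  proof (induction b arbitrary: x rule: dec_induct)
    case base
    then have "u = src B (x a)"
      using lab_inj[OF u path_vert] le_sum_eqD lab_sum[OF u] lab_sum[OF path_vert] by metis
    then show ?case using base by blast
  next
    case (step b)
    let ?w = "src B (x (Suc b))"
    have w: "?w \<in> verts B (Suc b)" using path_vert step.prems by blast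
    have "sum (lab u) UNIV \<le> b * d" using lab_sum[OF u] step.hyps by simp
    moreover have "b * d \<le> sum (lab ?w) UNIV" using lab_sum[OF w] by simp
    ultimately obtain h where h: "lab u \<le> h" "h \<le> lab ?w" "sum h UNIV = b * d"
      using exists_between_with_sum[OF step.prems(2)] by blast
    obtain v where v: "v \<in> verts B b" "lab v = h" using lab_surj[OF h(3)] by blast
    obtain e where e: "e \<in> edges B b" "src B e = v" "tgt B e = ?w"
      using edge_iff[OF v(1) w] h(2) v(2) by blast
    obtain z where z: "z \<in> path_space B" "\<And>n. n \<ge> Suc b \<Longrightarrow> z n = x n" "z b = e"
      using path_splice[OF step.prems(1) e(1,3)] by blast
    have "lab u \<le> lab (src B (z b))" using h(1) v(2) e(2) z(3) by simp
    then obtain y where "y \<in> path_space B" "\<forall>n\<ge>b. y n = z n" "src B (y a) = u"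
      using step.IH[OF z(1)] by blast
    then show ?case using z(2) by (intro bexI[of _ y]) auto
  qed
  then show ?thesis using that by blast
qed

lemma parsing_blocks:
  assumes x: "x \<in> regular_paths B \<xi>"
  shows "parsing (i * d) d (\<lambda>n. lab (src B (vershik_pow B \<xi> n x i)))
    (block_start (Suc i) x) (block_end (Suc i) x) (\<lambda>n. lab (src B (vershik_pow B \<xi> n x (Suc i))))"
  unfolding parsing_def
proof (intro conjI allI impI)
  let ?X = "\<lambda>n. vershik_pow B \<xi> n x"
  have X: "?X n \<in> path_space B" for n using regularD(1)[OF vershik_pow_regular[OF x]] .
  fix n m
  show "block_start (Suc i) x n \<le> n" "n < block_end (Suc i) x n" using block_bounds[OF x] by blast+
  show "sum (lab (src B (?X n (Suc i)))) UNIV = i * d + d"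
    using lab_sum[OF path_vert[OF X]] by simp
  have same: "\<forall>k\<ge>Suc i. ?X m k = ?X n k" "block_start (Suc i) x m = block_start (Suc i) x n"
    if "block_start (Suc i) x n \<le> m" "m < block_end (Suc i) x n" for m n
    using block_same[OF x that] by auto
  show "lab (src B (?X n (Suc i))) = lab (src B (?X m (Suc i)))"
    "block_end (Suc i) x n = block_end (Suc i) x m" "block_start (Suc i) x n = block_start (Suc i) x m"
    if "block_start (Suc i) x m \<le> n" "n < block_end (Suc i) x m"
    using same[OF that] by (auto simp: block_end_def)
  show "(\<lambda>n. lab (src B (?X n i))) ` {block_start (Suc i) x n..<block_end (Suc i) x n} =
      sources (i * d) (lab (src B (?X n (Suc i))))"
  proof
    show "(\<lambda>n. lab (src B (?X n i))) ` {block_start (Suc i) x n..<block_end (Suc i) x n} \<subseteq>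
        sources (i * d) (lab (src B (?X n (Suc i))))"
    proof (rule image_subsetI)
      fix m assume "m \<in> {block_start (Suc i) x n..<block_end (Suc i) x n}"
      then have "?X m (Suc i) = ?X n (Suc i)" using same(1)[of n m] by simp
      then show "lab (src B (?X m i)) \<in> sources (i * d) (lab (src B (?X n (Suc i))))"
        using path_lab_mono[OF X[of m], of i "Suc i"] lab_sum[OF path_vert[OF X]]
        by (simp add: sources_def)
    qed
    show "sources (i * d) (lab (src B (?X n (Suc i)))) \<subseteq>
        (\<lambda>n. lab (src B (?X n i))) ` {block_start (Suc i) x n..<block_end (Suc i) x n}"
    proof
      fix f assume f: "f \<in> sources (i * d) (lab (src B (?X n (Suc i))))"
      obtain u where u: "u \<in> verts B i" "lab u = f"
        using lab_surj[of f i] f by (auto simp: sources_def)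
      have "lab u \<le> lab (src B (?X n (Suc i)))" using f u(2) by (simp add: sources_def)
      then obtain y where y: "y \<in> path_space B" "\<And>k. k \<ge> Suc i \<Longrightarrow> y k = ?X n k" "src B (y i) = u"
        using path_through_lower_vertex[OF X u(1)] by (metis le_SucI order_refl)
      show "f \<in> (\<lambda>n. lab (src B (?X n i))) ` {block_start (Suc i) x n..<block_end (Suc i) x n}"
        using block_visits[where l = "Suc i" and n = n, OF x y(1,2)] y(3) u(2)
        by (intro image_eqI[of _ _ "block_start (Suc i) x n + int (rank (Suc i) y)"])
          (auto simp del: rank.simps)
    qed
  qed
qed

lemma next_parsing_blocks:
  assumes x: "x \<in> regular_paths B \<xi>"
  shows "next_parsing (i * d) d (\<lambda>n. lab (src B (vershik_pow B \<xi> n x (Suc i))))"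
  unfolding next_parsing_def
proof
  fix n
  let ?W = "\<lambda>n. lab (src B (vershik_pow B \<xi> n x (Suc i)))"
  let ?s = "block_start (Suc (Suc i)) x" and ?e = "block_end (Suc (Suc i)) x"
  let ?Z = "\<lambda>n. lab (src B (vershik_pow B \<xi> n x (Suc (Suc i))))"
  have p: "parsing (i * d + d) d ?W ?s ?e ?Z"
    using parsing_blocks[OF x, of "Suc i"] by (simp add: add.commute)
  have "\<forall>m. n \<le> m \<longrightarrow> m < ?e n \<longrightarrow> ?W m \<le> ?Z n"
    using parsing_mem[OF p, of n] parsingD(1)[OF p, of n] by (auto simp: sources_def)
  moreover have "?W ` {?e n..<?e (?e n)} = sources (i * d + d) (?Z (?e n))"
    using parsingD(6)[OF p, of "?e n"] parsing_end[OF p, of n] by simp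
  moreover have "n < ?e n" "?e n < ?e (?e n)" using parsingD(2)[OF p] by blast+
  moreover have "sum (?Z n) UNIV = i * d + d + d" "sum (?Z (?e n)) UNIV = i * d + d + d"
    using parsingD(7)[OF p] by blast+
  ultimately show "\<exists>a>n. \<exists>b>a. \<exists>z z'. sum z UNIV = i * d + d + d \<and> sum z' UNIV = i * d + d + d \<and>
      (\<forall>m. n \<le> m \<longrightarrow> m < a \<longrightarrow> ?W m \<le> z) \<and> ?W ` {a..<b} = sources (i * d + d) z'"
    by blast
qed

lemma same_words_blocks:
  assumes x: "x \<in> regular_paths B \<xi>" and x': "x' \<in> regular_paths B \<xi>"
    and U: "\<And>n. U n = lab (src B (vershik_pow B \<xi> n x i))"
    and U': "\<And>n. U n = lab (src B (vershik_pow B \<xi> n x' i))"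
  shows "same_words U
    (block_start (Suc i) x) (block_end (Suc i) x) (\<lambda>n. lab (src B (vershik_pow B \<xi> n x (Suc i))))
    (block_start (Suc i) x') (block_end (Suc i) x') (\<lambda>n. lab (src B (vershik_pow B \<xi> n x' (Suc i))))"
  unfolding same_words_def
proof (intro allI impI conjI)
  let ?X = "\<lambda>n. vershik_pow B \<xi> n x" and ?Y = "\<lambda>n. vershik_pow B \<xi> n x'"
  have X: "?X n \<in> path_space B" and Y: "?Y n \<in> path_space B" for n
    using regularD(1)[OF vershik_pow_regular] x x' by blast+
  fix n m assume "lab (src B (?X n (Suc i))) = lab (src B (?Y m (Suc i)))"
  then have eq: "src B (?X n (Suc i)) = src B (?Y m (Suc i))"
    using lab_inj path_vert X Y by blast
  then show len: "block_end (Suc i) x n - block_start (Suc i) x n =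
      block_end (Suc i) x' m - block_start (Suc i) x' m"
    by (simp add: block_end_def)
  fix r :: int assume r: "0 \<le> r" "r < block_end (Suc i) x n - block_start (Suc i) x n"
  let ?a = "block_start (Suc i) x n + r" and ?b = "block_start (Suc i) x' m + r"
  have a: "(\<forall>k\<ge>Suc i. ?X ?a k = ?X n k) \<and> block_start (Suc i) x ?a = block_start (Suc i) x n"
    using block_same[OF x, of "Suc i" n ?a] r by simp
  have b: "(\<forall>k\<ge>Suc i. ?Y ?b k = ?Y m k) \<and> block_start (Suc i) x' ?b = block_start (Suc i) x' m"
    using block_same[OF x', of "Suc i" m ?b] r len by simp
  have "block_start (Suc i) x ?a = ?a - int (rank (Suc i) (?X ?a))"
    "block_start (Suc i) x' ?b = ?b - int (rank (Suc i) (?Y ?b))"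
    by (rule block_start_def)+
  then have "rank (Suc i) (?X ?a) = rank (Suc i) (?Y ?b)" using a b by linarith
  moreover have "src B (?X ?a (Suc i)) = src B (?Y ?b (Suc i))" using a b eq by simp
  ultimately have "?X ?a i = ?Y ?b i" using rank_inj[OF X Y, of ?a "Suc i" ?b i] by blast
  then show "U ?a = U ?b" by (simp only: U[of ?a] U'[of ?b])
qed

section \<open>Consequences of a dense orbit\<close>

lemma path_through_vertex:
  assumes "v \<in> verts B L"
  obtains x where "x \<in> path_space B" "src B (x L) = v"
proof -
  have out: "\<exists>e \<in> edges B n. src B e = u" if "u \<in> verts B n" for n u
    using that diagram unfolding bratteli_diagram_def by blast
  have "\<exists>E. \<forall>n. (E n \<in> edges B (L + n) \<and> (n = 0 \<longrightarrow> src B (E n) = v)) \<and>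
      src B (E (Suc n)) = tgt B (E n)"
  proof (rule dependent_nat_choice)
    show "\<exists>e. e \<in> edges B (L + 0) \<and> (0 = 0 \<longrightarrow> src B e = v)" using out[OF assms] by auto
    show "\<exists>y. (y \<in> edges B (L + Suc n) \<and> (Suc n = 0 \<longrightarrow> src B y = v)) \<and> src B y = tgt B x"
      if "x \<in> edges B (L + n) \<and> (n = 0 \<longrightarrow> src B x = v)" for x n
      using out[OF edge_ends(2)[of x "L + n"]] that by auto
  qed
  then obtain E where E: "\<And>n. E n \<in> edges B (L + n) \<and> (n = 0 \<longrightarrow> src B (E n) = v)"
      "\<And>n. src B (E (Suc n)) = tgt B (E n)"
    by blast
  obtain \<gamma> where \<gamma>: "\<forall>n<L. \<gamma> n \<in> edges B n \<and>
      tgt B (\<gamma> n) = (if Suc n = L then v else src B (\<gamma> (Suc n)))"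
    using path_from_root_exists[OF assms] by blast
  define x where "x = (\<lambda>n. if n < L then \<gamma> n else E (n - L))"
  have "x n \<in> edges B n \<and> tgt B (x n) = src B (x (Suc n))" for n
  proof (cases "n < L")
    case True
    then show ?thesis using \<gamma> E(1)[of 0] by (auto simp: x_def)
  next
    case False
    then have "Suc n - L = Suc (n - L)" by simp
    then show ?thesis using False E(1)[of "n - L"] E(2)[of "n - L"] by (auto simp: x_def)
  qed
  then have "x \<in> path_space B" by (simp add: path_space_def)
  moreover have "src B (x L) = v" using E(1)[of 0] by (simp add: x_def)
  ultimately show ?thesis by (rule that)
qed

text \<open>A path whose orbit is dense eventually lies above every vertex.\<close>

lemma dense_eventually_above:
  assumes x: "x \<in> dense_orbit_paths B \<xi>" and v: "v \<in> verts B L"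
  obtains M where "\<And>l. l \<ge> M \<Longrightarrow> lab v \<le> lab (src B (x l))"
proof -
  obtain p where p: "p \<in> path_space B" "src B (p L) = v" using path_through_vertex[OF v] .
  have "openin (path_topology B) (cylinder B p L)"
    unfolding path_topology_def by (rule topology_generated_by_Basis) (use p in blast)
  moreover have "p \<in> cylinder B p L" using p by (simp add: cylinder_def)
  moreover have "p \<in> path_topology B closure_of orbit B x"
    using x p by (simp add: dense_orbit_paths_def)
  ultimately obtain y where y: "y \<in> orbit B x" "y \<in> cylinder B p L"
    unfolding in_closure_of by blast
  then obtain N where N: "\<forall>n\<ge>N. x n = y n" and yp: "y \<in> path_space B"
    by (auto simp: orbit_def tail_equiv_def)
  have "src B (y L) = v" using y(2) p by (simp add: cylinder_def)
  then have "lab v \<le> lab (src B (x l))" if "l \<ge> max N L" for l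
    using path_lab_mono[OF yp, of L l] N that by simp
  then show ?thesis by (rule that)
qed

lemma vershik_pow_tail:
  assumes x: "x \<in> regular_paths B \<xi>"
  shows "\<exists>M. \<forall>k\<ge>M. vershik_pow B \<xi> n x k = x k"
proof -
  have step: "\<exists>M. \<forall>k\<ge>M. vershik_pow B \<xi> (n + 1) x k = vershik_pow B \<xi> n x k" for n
  proof -
    let ?y = "vershik_pow B \<xi> n x"
    have y: "?y \<in> regular_paths B \<xi>" by (rule vershik_pow_regular[OF x])
    obtain l where "\<not> max_edge B \<xi> (?y l)" using regularD(3)[OF y] by blast
    then have "Suc (rank (Suc l) ?y) < height (Suc l) (src B (?y (Suc l)))"
      by (rule nonmax_edge_rank[OF regularD(1)[OF y]])
    then show ?thesis using vershik_regular(2)[OF y, of "Suc l"] vershik_pow_Suc[OF x, of n] by auto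
  qed
  show ?thesis
  proof (induction n rule: int_induct[where k = 0])
    case base
    then show ?case by (simp add: vershik_pow_0)
  next
    case (step1 n)
    then obtain M M' where "\<forall>k\<ge>M. vershik_pow B \<xi> n x k = x k"
      "\<forall>k\<ge>M'. vershik_pow B \<xi> (n + 1) x k = vershik_pow B \<xi> n x k" using step by blast
    then show ?case by (intro exI[of _ "max M M'"]) simp
  next
    case (step2 n)
    then obtain M M' where M: "\<forall>k\<ge>M. vershik_pow B \<xi> n x k = x k"
      "\<forall>k\<ge>M'. vershik_pow B \<xi> (n - 1 + 1) x k = vershik_pow B \<xi> (n - 1) x k" using step by blast
    have "vershik_pow B \<xi> (n - 1) x k = x k" if "k \<ge> max M M'" for k
      using that M(1)[rule_format, of k] M(2)[rule_format, of k] by simp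
    then show ?case by blast
  qed
qed

lemma dense_regular: "x \<in> dense_orbit_paths B \<xi> \<Longrightarrow> x \<in> regular_paths B \<xi>"
  by (simp add: dense_orbit_paths_def)

text \<open>A dense orbit visits every vertex before any given time. At a high level \<open>l\<close> where the edge of
  the path at time \<open>n0\<close> is not minimal, replace it by an edge that precedes it. When the path lies at least \<open>d\<close>
  above \<open>z\<close> in all coordinates, the source of that edge still lies above \<open>z\<close>, so some path through
  \<open>z\<close> arrives there; it precedes the path at time \<open>n0\<close>.\<close>

lemma dense_visits_past:
  assumes x: "x \<in> dense_orbit_paths B \<xi>" and z: "z \<in> verts B L"
  obtains n where "n < n0" "src B (vershik_pow B \<xi> n x L) = z"
proof -
  let ?x = "vershik_pow B \<xi> n0 x"
  have reg: "x \<in> regular_paths B \<xi>" "?x \<in> regular_paths B \<xi>"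
    using dense_regular[OF x] vershik_pow_regular by blast+
  have xp: "?x \<in> path_space B" using regularD(1)[OF reg(2)] .
  have "sum (\<lambda>a. lab z a + d) UNIV = (L + CARD('q)) * d"
    using lab_sum[OF z] by (simp add: sum.distrib algebra_simps)
  then obtain z' where z': "z' \<in> verts B (L + CARD('q))" "lab z' = (\<lambda>a. lab z a + d)"
    by (rule lab_surj)
  obtain M1 where M1: "\<And>l. l \<ge> M1 \<Longrightarrow> lab z' \<le> lab (src B (x l))"
    using dense_eventually_above[OF x z'(1)] by blast
  obtain M2 where M2: "\<forall>k\<ge>M2. ?x k = x k" using vershik_pow_tail[OF reg(1)] by blast
  obtain l where l: "l \<ge> max (max M1 M2) L" "\<not> min_edge B \<xi> (?x l)" using regularD(2)[OF reg(2)] by blast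
  let ?w = "tgt B (?x l)"
  have w: "?w \<in> verts B (Suc l)" using edge_ends(2) path_edge[OF xp] by blast
  have w_eq: "?w = src B (?x (Suc l))" by (rule path_tgt[OF xp])
  obtain e where e: "e \<in> edges B l" "tgt B e = ?w" "\<xi> e < \<xi> (?x l)"
    using l(2) incoming_eq[OF w] unfolding min_edge_def by (auto simp: not_le)
  have "lab z' \<le> lab ?w" using M1[of "Suc l"] M2 l(1) w_eq by simp
  have ev: "src B e \<in> verts B l" by (rule edge_ends(1)[OF e(1)])
  have ze: "lab z \<le> lab (src B e)"
  proof (rule le_funI)
    fix a
    have "codist a (lab (src B e)) \<le> codist a (lab ?w)"
      using edge_lab_le[OF e(1)] e(2) by (intro codist_mono) (simp add: le_fun_def)
    then have "lab ?w a \<le> lab (src B e) a + d"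
      using codist_add[of a "lab (src B e)"] codist_add[of a "lab ?w"] lab_sum[OF ev] lab_sum[OF w]
      by simp
    then show "lab z a \<le> lab (src B e) a"
      using le_funD[OF \<open>lab z' \<le> lab ?w\<close>, of a] z'(2) by simp
  qed
  obtain y1 where y1: "y1 \<in> path_space B" "\<And>n. n \<ge> Suc l \<Longrightarrow> y1 n = ?x n" "y1 l = e"
    using path_splice[OF xp e(1)] e(2) w_eq by metis
  obtain y where y: "y \<in> path_space B" "\<And>n. n \<ge> l \<Longrightarrow> y n = y1 n" "src B (y L) = z"
    using path_through_lower_vertex[OF y1(1) z, of l] ze y1(3) l(1) by auto
  have yx: "\<And>n. n \<ge> Suc l \<Longrightarrow> y n = ?x n" using y(2) y1(2) by simp
  have "\<xi> (y l) < \<xi> (?x l)" using y(2)[of l] y1(3) e(3) by simp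
  then have "rank (Suc l) y < rank (Suc l) ?x" using rank_Suc_less[where k = l, OF y(1) xp yx] by blast
  then have "block_start (Suc l) x n0 + int (rank (Suc l) y) < n0"
    by (simp add: block_start_def del: rank.simps)
  then show ?thesis using that block_visits(1)[OF reg(1) y(1) yx] y(3) by metis
qed

text \<open>Above level one, a vertex at distance one from a corner has two sources one level below, the corner and another
  vertex at distance one, so its height grows with the level.\<close>

lemma height_near_corner:
  assumes "v \<in> verts B l" "codist c (lab v) = 1"
  shows "l \<le> height l v"
  using assms
proof (induction l arbitrary: v)
  case (Suc l)
  show ?case
  proof (cases "l = 0")
    case True
    then show ?thesis using height_pos[OF Suc.prems(1)] by simp
  next
    case False
    have vc: "1 + lab v c = Suc l * d" using codist_add[of c "lab v"] Suc.prems lab_sum by metis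
    have ld: "d \<le> l * d" using False by simp
    have le1: "l * d \<le> lab v c" using vc d by simp
    note le = le1 order_trans[OF ld le1]
    have "sum ((lab v)(c := lab v c - d)) UNIV = l * d"
      using Suc.prems(2) vc le unfolding sum_upd by simp
    then obtain u where u: "u \<in> verts B l" "lab u = (lab v)(c := lab v c - d)"
      by (rule lab_surj)
    have "sum ((\<lambda>_. 0)(c := l * d)) UNIV = l * d"
      unfolding sum_upd by (simp add: codist_def)
    then obtain t where t: "t \<in> verts B l" "lab t = (\<lambda>_. 0)(c := l * d)"
      by (rule lab_surj)
    have "lab u \<le> lab v" "lab t \<le> lab v" using u(2) t(2) le by (auto simp: le_fun_def)
    then obtain e e' where e: "e \<in> edges B l" "src B e = u" "tgt B e = v"
      "e' \<in> edges B l" "src B e' = t" "tgt B e' = v"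
      using edge_iff[OF u(1) Suc.prems(1)] edge_iff[OF t(1) Suc.prems(1)] by blast
    have cu: "codist c (lab u) = 1" using u(2) Suc.prems(2) by simp
    have ct: "codist c (lab t) = 0" using t(2) by (simp add: codist_def)
    have "e \<noteq> e'" using e cu ct by auto
    then have "height l u + height l t = (\<Sum>a\<in>{e, e'}. height l (src B a))" using e by simp
    also have "\<dots> \<le> height (Suc l) v"
      using e incoming_eq[OF Suc.prems(1)] finite_incoming[OF Suc.prems(1)]
      by (simp only: height.simps, intro sum_mono2) auto
    finally show ?thesis using Suc.IH[OF u(1) cu] height_pos[OF t(1)] by simp
  qed
qed simp

text \<open>If the paths up to level \<open>i\<close> agree at all times, so do those up to level \<open>i + 1\<close>. The bound \<open>9\<close>
  comes from \<open>out_of_step_impossible\<close>.\<close>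

lemma same_coding_extends:
  assumes x: "x \<in> dense_orbit_paths B \<xi>" and x': "x' \<in> dense_orbit_paths B \<xi>"
    and q: "CARD('q) \<ge> 2" and i: "i \<ge> 9"
    and same: "\<And>n j. j < i \<Longrightarrow> vershik_pow B \<xi> n x j = vershik_pow B \<xi> n x' j"
    and j: "j < Suc i"
  shows "vershik_pow B \<xi> n x j = vershik_pow B \<xi> n x' j"
proof -
  let ?X = "\<lambda>n. vershik_pow B \<xi> n x" and ?Y = "\<lambda>n. vershik_pow B \<xi> n x'"
  have reg: "x \<in> regular_paths B \<xi>" "x' \<in> regular_paths B \<xi>" using dense_regular x x' by blast+
  have X: "?X n \<in> path_space B" and Y: "?Y n \<in> path_space B" for n
    using regularD(1)[OF vershik_pow_regular] reg by blast+
  have srci: "src B (?X n i) = src B (?Y n i)" for n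
    using path_tgt[OF X, of n "i - 1"] path_tgt[OF Y, of n "i - 1"] same[of "i - 1" n] i by simp
  define U where "U = (\<lambda>n. lab (src B (?X n i)))"
  have UX: "U n = lab (src B (?X n i))" and UY: "U n = lab (src B (?Y n i))" for n
    using srci by (simp_all add: U_def)
  let ?s = "block_start (Suc i) x" and ?e = "block_end (Suc i) x"
  let ?s' = "block_start (Suc i) x'" and ?e' = "block_end (Suc i) x'"
  let ?W = "\<lambda>n. lab (src B (?X n (Suc i)))" and ?W' = "\<lambda>n. lab (src B (?Y n (Suc i)))"
  have p: "parsing (i * d) d U ?s ?e ?W" unfolding U_def by (rule parsing_blocks[OF reg(1)])
  have "U = (\<lambda>n. lab (src B (?Y n i)))" using UY by blast
  then have p': "parsing (i * d) d U ?s' ?e' ?W'" using parsing_blocks[OF reg(2), of i] by simp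
  have c: "same_words U ?s ?e ?W ?s' ?e' ?W'" "same_words U ?s' ?e' ?W' ?s ?e ?W"
    using same_words_blocks[OF reg UX UY] same_words_blocks[OF reg(2,1) UY UX] by blast+
  have nx: "next_parsing (i * d) d ?W" "next_parsing (i * d) d ?W'"
    using next_parsing_blocks reg by blast+
  have k: "9 * d \<le> i * d" using i by simp
  define H where "H = Max (height (Suc i) ` verts B (Suc i))"
  have fin: "finite (verts B (Suc i))" using diagram by (simp add: bratteli_diagram_def)
  have H: "height (Suc i) v \<le> H" if "v \<in> verts B (Suc i)" for v
    unfolding H_def using fin that by simp
  obtain c c' :: 'q where cc': "c' \<noteq> c"
  proof -
    have "\<not> CARD('q) \<le> Suc 0" using q by simp
    then show ?thesis using that card_le_Suc0_iff_eq[of "UNIV :: 'q set"] by auto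
  qed
  have "sum ((\<lambda>_. 0)(c' := i * d)) UNIV = i * d" unfolding sum_upd by (simp add: codist_def)
  then obtain v where v: "v \<in> verts B i" "lab v = (\<lambda>_. 0)(c' := i * d)" by (rule lab_surj)
  have "2 \<le> i * d" using k d by linarith
  then have v2: "2 \<le> codist c (lab v)"
    using codist_ge[of c' c "lab v"] cc' v(2) by simp
  \<comment> \<open>a vertex \<open>z\<close> near the corner \<open>c\<close>, at a level so high that its blocks are longer than those of
    level \<open>i + 1\<close>\<close>
  define L where "L = Suc (H + i)"
  let ?f = "((\<lambda>_. 0)(c' := 1))(c := L * d - 1)"
  have f1: "codist c ?f = 1"
    using cc' by (simp add: codist_def sum.remove[of "UNIV - {c}" c'])
  have "L * d \<ge> 1" using d by (simp add: L_def)
  then have "sum ?f UNIV = L * d" using codist_add[of c ?f] f1 by simp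
  then obtain z where z: "z \<in> verts B L" "lab z = ?f" by (rule lab_surj)
  have z1: "codist c (lab z) = 1" using f1 z(2) by simp
  \<comment> \<open>Before time \<open>n\<close> the orbit of \<open>x\<close> traverses a block \<open>[S, E)\<close> of \<open>z\<close>, near the corner, and leaves the
    neighbourhood of the corner at some later time \<open>m < n\<close>.\<close>
  obtain n1 where n1: "n1 < n" "src B (?X n1 i) = v" using dense_visits_past[OF x v(1)] by blast
  obtain n2 where n2: "n2 < n1" "src B (?X n2 L) = z" using dense_visits_past[OF x z(1)] by blast
  define S where "S = block_start L x n2"
  define E where "E = block_end L x n2"
  have SE: "S \<le> n2" "n2 < E" using block_bounds[OF reg(1)] by (auto simp: S_def E_def)
  have long: "S + int L \<le> E"
    using height_near_corner[OF z(1) z1] n2(2) by (simp add: S_def E_def block_end_def)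
  have near: "codist c (U l) \<le> 1" if "S \<le> l" "l < E" for l
  proof -
    have "src B (?X l L) = z" using block_same[OF reg(1), of L n2 l] that n2(2) by (simp add: S_def E_def)
    then have "lab (src B (?X l i)) \<le> lab z" using path_lab_mono[OF X, of i L l] by (simp add: L_def)
    then show ?thesis using codist_mono[of c "U l" "lab z"] z1 by (simp add: UX le_fun_def)
  qed
  let ?M = "{m \<in> {n2..n1}. 2 \<le> codist c (U m)}"
  define m where "m = Min ?M"
  have fin_M: "finite ?M" by (rule finite_subset[of _ "{n2..n1}"]) auto
  have "n1 \<in> ?M" using n1(2) n2(1) v2 by (simp add: UX)
  then have mM: "m \<in> ?M" unfolding m_def using fin_M by (intro Min_in) auto
  have below_m: "codist c (U l) \<le> 1" if "S \<le> l" "l < m" for l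
  proof (cases "l < n2")
    case True
    then show ?thesis using near that SE by simp
  next
    case False
    have "l \<notin> ?M"
    proof
      assume "l \<in> ?M"
      then have "m \<le> l" unfolding m_def using fin_M by (intro Min_le) auto
      then show False using that by simp
    qed
    then show ?thesis using False that(2) mM by auto
  qed
  have "E \<le> m"
  proof (rule ccontr)
    assume "\<not> E \<le> m"
    then show False using near[of m] mM SE by simp
  qed
  have late: "S \<le> ?s m" "S \<le> ?s' m"
  proof -
    have "m < ?e m" "m < ?e' m" using block_bounds reg by blast+
    moreover have "height (Suc i) (src B (?X m (Suc i))) \<le> H" "height (Suc i) (src B (?Y m (Suc i))) \<le> H"
      using H path_vert X Y by blast+
    ultimately show "S \<le> ?s m" "S \<le> ?s' m"
      using long \<open>E \<le> m\<close> unfolding block_end_def L_def by linarith+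
  qed
  have "2 \<le> codist c (U m)" using mM by simp
  then have eq: "?s m = ?s' m"
    by (intro exit_common_boundary[OF p p' c nx d k, of S m c]) (use below_m late in auto)
  have "?s m \<le> n" using block_bounds(1)[OF reg(1), of "Suc i" m] mM n1(1) by simp
  then have sync: "?s n = ?s' n \<and> ?e n = ?e' n \<and> ?W n = ?W' n"
    using parsing_start(1)[OF p, of m] parsing_start(1)[OF p', of m] eq
    by (intro common_boundary_sync[OF p p' c nx d k, of "?s m"]) auto
  then have "rank (Suc i) (?X n) = rank (Suc i) (?Y n)" by (simp add: block_start_def)
  moreover have "src B (?X n (Suc i)) = src B (?Y n (Suc i))"
    using sync lab_inj path_vert X Y by blast
  ultimately show ?thesis using rank_inj[OF X Y] j by blast
qed

lemma coding_eq_iff: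
  "coding B \<xi> i x = coding B \<xi> i x' \<longleftrightarrow> (\<forall>n. \<forall>j<i. vershik_pow B \<xi> n x j = vershik_pow B \<xi> n x' j)"
  by (auto simp: coding_def fun_eq_iff)

lemma coding_eq_Suc:
  assumes "x \<in> dense_orbit_paths B \<xi>" "x' \<in> dense_orbit_paths B \<xi>" "CARD('q) \<ge> 2" "i \<ge> 9"
    and "coding B \<xi> i x = coding B \<xi> i x'"
  shows "coding B \<xi> (Suc i) x = coding B \<xi> (Suc i) x'"
  using same_coding_extends[OF assms(1-4)] assms(5) unfolding coding_eq_iff by blast

lemma coding_injective:
  assumes q: "CARD('q) \<ge> 2"
  shows "inj_on (coding B \<xi> 9) (dense_orbit_paths B \<xi>)"
proof (rule inj_onI)
  fix x x' assume x: "x \<in> dense_orbit_paths B \<xi>" and x': "x' \<in> dense_orbit_paths B \<xi>"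
    and eq: "coding B \<xi> 9 x = coding B \<xi> 9 x'"
  have all: "coding B \<xi> i x = coding B \<xi> i x'" if "i \<ge> 9" for i
    using that by (induction i rule: dec_induct) (use eq coding_eq_Suc[OF x x' q] in auto)
  show "x = x'"
  proof
    fix j
    have "vershik_pow B \<xi> 0 x j = vershik_pow B \<xi> 0 x' j"
      using all[of "j + 9"] unfolding coding_eq_iff by simp
    then show "x j = x' j" by (simp add: vershik_pow_0)
  qed
qed

end

section \<open>Diagrams of polynomial shape\<close>

lemma labelled_of_polynomial_shape:
  fixes B :: "('v, 'e) bratteli" and p :: "('q::finite \<Rightarrow>\<^sub>0 nat) \<Rightarrow>\<^sub>0 int"
  assumes shape: "polynomial_shape B p d" and ord: "edge_ordering B \<xi>"
  obtains lab :: "'v \<Rightarrow> 'q \<Rightarrow> nat" where "labelled_bratteli B \<xi> lab d"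
proof -
  obtain \<phi> :: "'v \<Rightarrow> ('q \<Rightarrow>\<^sub>0 nat)" where bij: "\<And>n. bij_betw \<phi> (verts B n) (vecs_of_sum (n * d))"
    and edge: "\<And>n u w. u \<in> verts B n \<Longrightarrow> w \<in> verts B (Suc n) \<Longrightarrow>
      (\<exists>e \<in> edges B n. src B e = u \<and> tgt B e = w) \<longleftrightarrow> (\<exists>s \<in> vecs_of_sum d. \<phi> w = \<phi> u + s)"
    using shape unfolding polynomial_shape_def by blast
  have diag: "bratteli_diagram B" and d: "d \<ge> 1" using shape unfolding polynomial_shape_def by blast+
  let ?lab = "\<lambda>v. Poly_Mapping.lookup (\<phi> v)"
  have vec: "bij_betw Poly_Mapping.lookup (vecs_of_sum k) {f :: 'q \<Rightarrow> nat. sum f UNIV = k}" for k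
  proof (rule bij_betwI[where g = Abs_poly_mapping])
    show "Poly_Mapping.lookup \<in> vecs_of_sum k \<rightarrow> {f :: 'q \<Rightarrow> nat. sum f UNIV = k}"
      by (auto simp: vecs_of_sum_def vec_sum_def)
    show "Abs_poly_mapping \<in> {f :: 'q \<Rightarrow> nat. sum f UNIV = k} \<rightarrow> vecs_of_sum k"
      by (auto simp: vecs_of_sum_def vec_sum_def lookup_Abs_poly_mapping)
  qed (auto simp: lookup_Abs_poly_mapping)
  have lab: "bij_betw ?lab (verts B n) {f. sum f UNIV = n * d}" for n
    using bij_betw_trans[OF bij[of n] vec[of "n * d"]] by (simp add: comp_def)
  have "labelled_bratteli B \<xi> ?lab d"
  proof
    show "bratteli_diagram B" by (rule diag)
    show "edge_ordering B \<xi>" by (rule ord)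
    show "d \<ge> 1" by (rule d)
    show "bij_betw ?lab (verts B n) {f. sum f UNIV = n * d}" for n by (rule lab)
    fix n u w assume u: "u \<in> verts B n" and w: "w \<in> verts B (Suc n)"
    have sums: "sum (?lab u) UNIV = n * d" "sum (?lab w) UNIV = Suc n * d"
      using bij_betw_apply[OF lab u] bij_betw_apply[OF lab w] by auto
    have "(\<exists>s \<in> vecs_of_sum d. \<phi> w = \<phi> u + s) \<longleftrightarrow> ?lab u \<le> ?lab w"
    proof
      assume "\<exists>s \<in> vecs_of_sum d. \<phi> w = \<phi> u + s"
      then show "?lab u \<le> ?lab w" by (auto simp: le_fun_def lookup_add)
    next
      assume le: "?lab u \<le> ?lab w"
      have add: "\<phi> w = \<phi> u + (\<phi> w - \<phi> u)"
        using le by (intro poly_mapping_eqI) (auto simp: lookup_add lookup_minus le_fun_def)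
      have "vec_sum (\<phi> w - \<phi> u) = sum (?lab w) UNIV - sum (?lab u) UNIV"
        using le unfolding vec_sum_def by (simp add: lookup_minus sum_subtractf_nat le_fun_def)
      then have "\<phi> w - \<phi> u \<in> vecs_of_sum d" using sums by (simp add: vecs_of_sum_def)
      then show "\<exists>s \<in> vecs_of_sum d. \<phi> w = \<phi> u + s" using add by blast
    qed
    then show "(\<exists>e \<in> edges B n. src B e = u \<and> tgt B e = w) \<longleftrightarrow> ?lab u \<le> ?lab w"
      using edge[OF u w] by simp
  qed
  then show ?thesis by (rule that)
qed

theorem theorem6p3:
  fixes B :: "('v, 'e) bratteli"
    and p :: "('q::finite \<Rightarrow>\<^sub>0 nat) \<Rightarrow>\<^sub>0 int"
    and d :: nat
  assumes "CARD('q) \<ge> 2"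
    and "polynomial_shape B p d"
  shows "(\<forall>\<xi>. edge_ordering B \<xi> \<longrightarrow>
            (\<exists>N. \<forall>i\<ge>N. \<not> (\<exists>x \<in> dense_orbit_paths B \<xi>. \<exists>x' \<in> dense_orbit_paths B \<xi>.
                                depth_pair B \<xi> i x x')))
         \<and> inherently_expansive B"
proof
  show "\<forall>\<xi>. edge_ordering B \<xi> \<longrightarrow>
      (\<exists>N. \<forall>i\<ge>N. \<not> (\<exists>x \<in> dense_orbit_paths B \<xi>. \<exists>x' \<in> dense_orbit_paths B \<xi>.
        depth_pair B \<xi> i x x'))"
  proof (intro allI impI exI[of _ 9])
    fix \<xi> and i :: nat assume ord: "edge_ordering B \<xi>" and i: "9 \<le> i"
    obtain lab :: "'v \<Rightarrow> 'q \<Rightarrow> nat" where "labelled_bratteli B \<xi> lab d"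
      using labelled_of_polynomial_shape[OF assms(2) ord] .
    then show "\<not> (\<exists>x \<in> dense_orbit_paths B \<xi>. \<exists>x' \<in> dense_orbit_paths B \<xi>. depth_pair B \<xi> i x x')"
      using labelled_bratteli.coding_eq_Suc[of B \<xi> lab d] assms(1) i unfolding depth_pair_def by blast
  qed
  show "inherently_expansive B"
    unfolding inherently_expansive_def expansive_def
  proof (intro allI impI exI[of _ 9] conjI)
    fix \<xi> assume ord: "edge_ordering B \<xi>"
    obtain lab :: "'v \<Rightarrow> 'q \<Rightarrow> nat" where "labelled_bratteli B \<xi> lab d"
      using labelled_of_polynomial_shape[OF assms(2) ord] .
    then show "inj_on (coding B \<xi> 9) (dense_orbit_paths B \<xi>)"
      using labelled_bratteli.coding_injective assms(1) by blast
  qed simp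
qed

end
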